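(* Let $b\gg(\log n)^3$ and let the communities be balanced ($\mathcal C\in\mathcal S_k^{\nu}$ with $\nu=1$). Let $\mu_{n0}=\mathbb{E}_{\mathbf 1,a,b}[d_1]$ and $\sigma_{n0}^2=\mathrm{Var}_{\mathbf 1,a,b}[d_1]$. Then, for every fixed $y\in\mathbb{R}$, as $n\to\infty$, $$\mathbb{P}_{\mathbf 1,a,b}\left[\frac{\max_i d_i-\mu_{n0}}{\sigma_{n0}}\le\sqrt{2\log n}\left(1-\frac{\log\log n+\log(4\pi)}{4\log n}+\frac{y}{2\log n}\right)\right]\to\exp\left[-e^{-y}\right].$$
   Context: $k$ is a fixed number of communities, $\mathcal C=\{\tilde S_1,\dots,\tilde S_k\}$ is a partition of $[n]$ into $k$ blocks; $\mathcal S_k^{1}$ is the set of partitions with all $|\tilde S_l|=n/k$. $\mathbb{P}_{\mathbf 1,a,b}=\mathbb{P}^{(\mathcal C)}_{\mathbf 1,a,b}$ is the law of the stochastic block model: a simple graph on $[n]$ with adjacency matrix $(Y_{ij})$, edges independent, with edge probability $\frac an$ if $i,j$ are in the same block and $\frac bn$ otherwise; $\mathbb{E}_{\mathbf 1,a,b},\mathrm{Var}_{\mathbf 1,a,b}$ are the corresponding expectation and variance. $d_i=\sum_{j\ne i}Y_{ij}$ is the degree of $i$. Standing assumptions on the sequences $a=a_n,b=b_n$: $0<b<a\le n/2$; $0<\liminf\frac ba\le\limsup\frac ba<1$; $\lim a/n$ and $\lim b/n$ exist. $x_n\gg y_n$ means $x_n/y_n\to\infty$. *)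

theory Defs
  imports "HOL-Probability.Probability" "HOL-Library.Disjoint_Sets"
begin

definition balanced_partitions :: "nat \<Rightarrow> nat \<Rightarrow> nat set set set" where
  "balanced_partitions k n =
     {C. partition_on {1..n} C \<and> card C = k \<and> (\<forall>S\<in>C. real (card S) = real n / real k)}"

text \<open>Balanced partitions of \<open>{1..n}\<close> into \<open>k\<close> blocks exist only if \<open>k\<close> divides \<open>n\<close>, so
  \<open>n\<close> tends to infinity through the multiples of \<open>k\<close>.\<close>

definition multiples_at_top :: "nat \<Rightarrow> nat filter" where
  "multiples_at_top k = inf sequentially (principal {n. k dvd n})"

definition possible_edges :: "nat \<Rightarrow> nat set set" where
  "possible_edges n = {e. e \<subseteq> {1..n} \<and> card e = 2}"

text \<open>A simple graph on \<open>{1..n}\<close> is represented by the indicator \<open>G\<close> of its edges, the edge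
  \<open>ij\<close> being the two-element set \<open>{i, j}\<close>; \<open>G e = False\<close> for \<open>e \<notin> possible_edges n\<close>.\<close>

definition sbm_pmf :: "nat \<Rightarrow> nat set set \<Rightarrow> real \<Rightarrow> real \<Rightarrow> (nat set \<Rightarrow> bool) pmf" where
  "sbm_pmf n C a b =
     Pi_pmf (possible_edges n) False
       (\<lambda>e. bernoulli_pmf (if \<exists>S\<in>C. e \<subseteq> S then a / real n else b / real n))"

definition adj :: "(nat set \<Rightarrow> bool) \<Rightarrow> nat \<Rightarrow> nat \<Rightarrow> real" where
  "adj G i j = of_bool (G {i, j})"

definition vertex_degree :: "nat \<Rightarrow> (nat set \<Rightarrow> bool) \<Rightarrow> nat \<Rightarrow> real" where
  "vertex_degree n G i = (\<Sum>j\<in>{1..n} - {i}. adj G i j)"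

end

theory Submission
  imports Defs "HOL-Real_Asymp.Real_Asymp"
begin

text \<open>
  Let \<open>\<mu>\<close> and \<open>\<sigma>\<^sup>2\<close> be the mean and the variance of a degree, let \<open>x\<close> be the threshold in the theorem and
  \<open>t = \<mu> + \<sigma> x\<close>. The maximum is at most \<open>t\<close> iff no vertex has degree above \<open>t\<close>, and the number of vertices with
  degree above \<open>t\<close> is asymptotically Poisson with mean \<open>exp (- y)\<close>. Two facts give this.

  For a single vertex, the degree is a sum of independent Bernoulli variables. The threshold satisfies \<open>x \<sim> sqrt (2 ln n)\<close>,
  and \<open>b \<gg> (ln n)\<^sup>3\<close> implies that \<open>x\<^sup>3 / \<sigma>\<close> tends to \<open>0\<close>, which is the range in which the tail of such a sum
  is equivalent to the Gaussian tail \<open>exp (- x\<^sup>2 / 2) / (x sqrt (2 \<pi>))\<close> (\<open>poisson_binomial_moderate_deviation\<close>).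
  By the choice of \<open>x\<close>, \<open>n\<close> times this tail tends to \<open>exp (- y)\<close> (\<open>gaussian_tail_near_gumbel_threshold\<close>).
  The tail estimate is a saddle point argument. The tail probability is a contour integral of the generating function
  over the circle of radius \<open>exp \<theta>\<close> with \<open>\<theta> = x / \<sigma>\<close>, where the sum over all values above \<open>t\<close> has
  become a geometric series that contributes the factor \<open>1 / \<theta>\<close>. At the angle \<open>u / \<sigma>\<close> the integrand is, up to the
  factor \<open>exp (- x\<^sup>2 / 2)\<close>, close to \<open>exp (- u\<^sup>2 / 2)\<close>, so that dominated convergence applies.

  Jointly, two degrees are dependent only through the one edge that they share. For a set \<open>A\<close> of \<open>r\<close>
  vertices, the numbers of neighbours outside \<open>A\<close> are independent, and they differ from the degrees by at most \<open>r\<close>.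
  Hence the probability that all degrees in \<open>A\<close> exceed \<open>t\<close> lies between \<open>Q (t + r) ^ r\<close> and \<open>Q (t - r) ^ r\<close>,
  \<open>Q\<close> being the tail of one degree (\<open>joint_exceedance_bounds\<close>). A shift of \<open>t\<close> by \<open>r\<close> changes \<open>x\<close> by
  \<open>r / \<sigma>\<close>, which is \<open>o (1 / sqrt (ln n))\<close> and leaves the limit of \<open>n Q\<close> unchanged. So all factorial moments
  of the number of exceedances converge to those of the Poisson law, and the Bonferroni inequalities turn this into the
  limit of the probability that there is none (\<open>prob_no_event_tendsto_poisson\<close>).
\<close>

section \<open>The moment generating function of a Bernoulli variable\<close>

lemma norm_exp_minus_quadratic_le:
  fixes z :: complex
  assumes "norm z \<le> c"
  shows "norm (exp z - (1 + z + z\<^sup>2 / 2)) \<le> exp c / 2 * norm z ^ 3"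
proof -
  have "norm (exp z - (1 + z + z\<^sup>2 / 2)) \<le> exp (norm z) * norm z ^ 3 / 2"
    using Taylor_exp_field[of z 2] by (simp add: numeral_2_eq_2 numeral_3_eq_3 add.assoc)
  also have "\<dots> \<le> exp c / 2 * norm z ^ 3"
    using assms by (simp add: mult_right_mono)
  finally show ?thesis .
qed

text \<open>
  The cumulant expansion of a Bernoulli variable to second order, in multiplicative form so that no branch of the
  complex logarithm has to be chosen. The moment generating function and
  the Gaussian exponential agree up to terms of third order in \<open>z\<close>. The factor \<open>p\<close> in
  the error matters: summed over many variables it makes the error a multiple of \<open>norm z ^ 3\<close> times the mean.
\<close>

lemma bernoulli_mgf_approx:
  fixes p :: real and z :: complex
  assumes p: "0 \<le> p" "p \<le> 1" and z: "norm z \<le> 1"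
  shows "norm ((1 - p + p * exp z) * exp (- (p * z + p * (1 - p) * z\<^sup>2 / 2)) - 1)
           \<le> 128 * p * norm z ^ 3"
proof -
  have np: "norm (1 - complex_of_real p) = 1 - p"
    using p norm_of_real[of "1 - p", where 'a = complex] by simp
  define A where "A = p * z + p * (1 - p) * z\<^sup>2 / 2"
  have e1: "exp (1::real) \<le> 3"
    using e_less_272 by simp
  have "exp (2::real) = exp 1 * exp 1"
    by (simp flip: exp_add)
  also have "\<dots> \<le> 272/100 * (272/100)"
    by (intro mult_mono) (use e_less_272 in auto)
  finally have e2: "exp (2::real) \<le> 8"
    by simp
  have "norm A \<le> norm (p * z) + norm (p * (1 - p) * z\<^sup>2 / 2)"
    unfolding A_def by (rule norm_triangle_ineq)
  also have "norm (p * z) = p * norm z"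
    using p by (simp add: norm_mult)
  also have "norm (p * (1 - p) * z\<^sup>2 / 2) = (p * norm z) * ((1 - p) * norm z / 2)"
    using p by (simp add: norm_mult norm_divide norm_power power2_eq_square np)
  also have "(1 - p) * norm z / 2 \<le> 1 * 1 / 2"
    using p z by (intro divide_right_mono mult_mono) auto
  finally have A1: "norm A \<le> 3 / 2 * (p * norm z)"
    using p by (simp add: mult_left_mono)
  have pz: "p * norm z \<le> 1"
    using p z by (simp add: mult_le_one)
  have A2: "norm A \<le> 2"
    using A1 pz by simp
  have R: "norm (exp z - (1 + z + z\<^sup>2 / 2)) \<le> 3 / 2 * norm z ^ 3"
  proof -
    have "norm (exp z - (1 + z + z\<^sup>2 / 2)) \<le> exp 1 / 2 * norm z ^ 3"
      by (rule norm_exp_minus_quadratic_le[OF z])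
    also have "\<dots> \<le> 3 / 2 * norm z ^ 3"
      using e1 by (intro mult_right_mono) auto
    finally show ?thesis .
  qed
  have RA: "norm (exp A - (1 + A + A\<^sup>2 / 2)) \<le> 27 / 2 * (p * norm z ^ 3)"
  proof -
    have "norm (exp A - (1 + A + A\<^sup>2 / 2)) \<le> exp 2 / 2 * norm A ^ 3"
      by (rule norm_exp_minus_quadratic_le[OF A2])
    also have "\<dots> \<le> 8 / 2 * (3 / 2 * (p * norm z)) ^ 3"
      using e2 A1 by (intro mult_mono power_mono) auto
    also have "\<dots> = 27 / 2 * (p ^ 3 * norm z ^ 3)"
      by (simp add: power_mult_distrib power_divide)
    also have "p ^ 3 \<le> p"
      using p power_decreasing[of 1 3 p] by simp
    finally show ?thesis
      by (simp add: mult_right_mono mult_left_mono)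
  qed
  have Q: "norm (A\<^sup>2 / 2 - p\<^sup>2 * z\<^sup>2 / 2) \<le> p * norm z ^ 3"
  proof -
    have "A\<^sup>2 / 2 - p\<^sup>2 * z\<^sup>2 / 2 = p * (p * (1 - p)) * z ^ 3 / 2 * (1 + (1 - p) * z / 4)"
      unfolding A_def power2_eq_square power3_eq_cube by (simp add: field_simps)
    also have "norm \<dots> = (p * (p * (1 - p))) * norm z ^ 3 / 2 * norm (1 + (1 - p) * z / 4)"
      using p by (simp add: norm_mult norm_divide norm_power np)
    also have "norm (1 + (1 - p) * z / 4) \<le> 1 + norm ((1 - p) * z / 4)"
      by (metis norm_one norm_triangle_ineq)
    also have "norm ((1 - p) * z / 4) = (1 - p) * norm z / 4"
      using p by (simp add: norm_mult norm_divide np)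
    also have "\<dots> \<le> 1 * 1 / 4"
      using p z by (intro divide_right_mono mult_mono) auto
    also have "p * (p * (1 - p)) * norm z ^ 3 / 2 * (1 + 1 * 1 / 4)
        \<le> (p * 1) * norm z ^ 3 / 2 * (1 + 1 * 1 / 4)"
      using p by (intro mult_right_mono divide_right_mono mult_left_mono mult_le_one) auto
    also have "\<dots> \<le> p * norm z ^ 3"
      using p by simp
    finally show ?thesis
      using p by (simp add: mult_left_mono)
  qed
  have eq: "(1 - p + p * exp z) * exp (- A) - 1 = exp (- A) * (1 - p + p * exp z - exp A)"
    by (simp add: algebra_simps flip: exp_add)
  \<comment> \<open>The terms of degree at most two cancel; what is left are the two Taylor remainders and the excess of \<open>A\<^sup>2\<close> over its leading term.\<close>
  have "1 - p + p * exp z - exp A =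
      p * (exp z - (1 + z + z\<^sup>2 / 2)) - (exp A - (1 + A + A\<^sup>2 / 2)) - (A\<^sup>2 / 2 - p\<^sup>2 * z\<^sup>2 / 2)"
    unfolding A_def by (simp add: field_simps power2_eq_square)
  also have "norm \<dots> \<le> norm (p * (exp z - (1 + z + z\<^sup>2 / 2))) + norm (exp A - (1 + A + A\<^sup>2 / 2))
      + norm (A\<^sup>2 / 2 - p\<^sup>2 * z\<^sup>2 / 2)"
    by (meson norm_triangle_ineq4 add_mono order_refl order_trans)
  also have "\<dots> \<le> p * (3 / 2 * norm z ^ 3) + 27 / 2 * (p * norm z ^ 3) + p * norm z ^ 3"
  proof (intro add_mono RA Q)
    show "norm (p * (exp z - (1 + z + z\<^sup>2 / 2))) \<le> p * (3 / 2 * norm z ^ 3)"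
      unfolding norm_mult norm_of_real using p R by (intro mult_mono) auto
  qed
  also have "\<dots> = 16 * (p * norm z ^ 3)"
    by simp
  finally have D: "norm (1 - p + p * exp z - exp A) \<le> 16 * (p * norm z ^ 3)" .
  have "norm (exp (- A)) \<le> exp (norm A)"
    using norm_exp[of "- A"] by simp
  also have "\<dots> \<le> exp 2"
    using A2 by simp
  also note e2
  finally have "norm (exp (- A)) \<le> 8" .
  hence "norm (exp (- A)) * norm (1 - p + p * exp z - exp A) \<le> 8 * (16 * (p * norm z ^ 3))"
    using D by (intro mult_mono) auto
  thus ?thesis
    unfolding A_def[symmetric] eq by (simp add: norm_mult)
qed

text \<open>
  With \<open>t = \<bar>s\<bar> / 2\<close> this is \<open>sin t \<ge> t / 2\<close> on \<open>[0, pi / 2]\<close>, which holds there since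
  \<open>sin t \<ge> t - t\<^sup>3 / 6\<close> and \<open>t\<^sup>2 \<le> 3\<close>. It turns the decay of the characteristic function into a Gaussian bound.
\<close>

lemma one_minus_cos_ge:
  fixes s :: real
  assumes "\<bar>s\<bar> \<le> pi"
  shows "s\<^sup>2 / 8 \<le> 1 - cos s"
proof -
  define t where "t = \<bar>s\<bar> / 2"
  have t: "0 \<le> t" "t \<le> pi / 2"
    using assms by (auto simp: t_def)
  have "t \<le> 16 / 10"
    using t pi_approx by simp
  hence t2: "t\<^sup>2 \<le> 3"
    using t power_mono[of t "16/10" 2] by (simp add: power2_eq_square)
  have "\<bar>sin t - t\<bar> \<le> t ^ 3 / 6"
    using Maclaurin_sin_bound[of t 3] t(1) by (simp add: numeral_3_eq_3 sin_coeff_def fact_numeral)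
  moreover have "t ^ 3 / 6 = t * (t\<^sup>2 / 6)"
    by (simp add: power3_eq_cube power2_eq_square)
  ultimately have "sin t \<ge> t - t * (t\<^sup>2 / 6)"
    by linarith
  moreover have "t * (t\<^sup>2 / 6) \<le> t * (3 / 6)"
    using t t2 by (intro mult_left_mono) auto
  ultimately have "t / 2 \<le> sin t"
    by simp
  hence "(t / 2)\<^sup>2 \<le> (sin t)\<^sup>2"
    using t by (intro power_mono) auto
  moreover have "cos s = 1 - 2 * (sin t)\<^sup>2"
    using cos_double_sin[of t] by (simp add: t_def)
  moreover have "(t / 2)\<^sup>2 = s\<^sup>2 / 16"
    by (simp add: t_def power_divide)
  ultimately show ?thesis
    by simp
qed

text \<open>
  The square of the left-hand side is \<open>D\<^sup>2 - 2 p (1 - p) exp \<theta> (1 - cos s)\<close> with \<open>D\<close> the value at \<open>s = 0\<close>.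
  Divided by \<open>D\<^sup>2 \<le> exp (2 \<theta>)\<close>, the quantity \<open>p (1 - p) exp \<theta>\<close> becomes the variance of the exponentially tilted
  variable, which is at least \<open>exp (- \<theta>)\<close> times the original one.
\<close>

lemma norm_bernoulli_mgf_le:
  fixes p \<theta> s :: real
  assumes p: "0 \<le> p" "p \<le> 1" and \<theta>: "0 \<le> \<theta>"
  shows "norm (1 - p + p * exp (Complex \<theta> s))
           \<le> (1 - p + p * exp \<theta>) * exp (- (p * (1 - p) * exp (- \<theta>) * (1 - cos s)))"
proof -
  define D where "D = 1 - p + p * exp \<theta>"
  define v where "v = p * (1 - p) * exp (- \<theta>) * (1 - cos s)"
  have e: "exp \<theta> \<ge> 1"
    using \<theta> by simp
  have D: "1 \<le> D" "D \<le> exp \<theta>"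
  proof -
    have "p * (exp \<theta> - 1) \<ge> 0" "(1 - p) * (exp \<theta> - 1) \<ge> 0"
      using e p by auto
    thus "1 \<le> D" "D \<le> exp \<theta>"
      by (auto simp: D_def algebra_simps)
  qed
  have "(norm (1 - p + p * exp (Complex \<theta> s)))\<^sup>2
      = (1 - p + p * exp \<theta> * cos s)\<^sup>2 + (p * exp \<theta> * sin s)\<^sup>2"
    unfolding cmod_power2 by (simp add: Re_exp Im_exp mult.assoc)
  also have "\<dots> = (1 - p)\<^sup>2 + 2 * (1 - p) * p * exp \<theta> * cos s
      + (p * exp \<theta>)\<^sup>2 * ((cos s)\<^sup>2 + (sin s)\<^sup>2)"
    by algebra
  also have "\<dots> = D\<^sup>2 - 2 * (p * (1 - p) * (1 - cos s)) * exp \<theta>"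
    unfolding sin_cos_squared_add2 by (simp add: D_def power2_eq_square algebra_simps)
  also have "\<dots> \<le> D\<^sup>2 - D\<^sup>2 * (2 * v)"
  proof -
    have "D\<^sup>2 * (2 * v) \<le> (exp \<theta>)\<^sup>2 * (2 * v)"
      using D p by (intro mult_right_mono power_mono) (auto simp: v_def)
    also have "\<dots> = 2 * (p * (1 - p) * (1 - cos s)) * exp \<theta>"
      by (simp add: v_def power2_eq_square exp_minus field_simps)
    finally show ?thesis by simp
  qed
  also have "\<dots> = D\<^sup>2 * (1 + - (2 * v))"
    by (simp add: algebra_simps)
  also have "\<dots> \<le> D\<^sup>2 * exp (- (2 * v))"
    by (intro mult_left_mono exp_ge_add_one_self) auto
  also have "\<dots> = (D * exp (- v))\<^sup>2"
    by (simp add: power_mult_distrib flip: exp_double)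
  finally show ?thesis
    unfolding D_def[symmetric] v_def[symmetric] by (rule power2_le_imp_le) (use D in auto)
qed

section \<open>Tails of a distribution on the naturals as contour integrals\<close>

text \<open>
  Orthogonality of the powers on the circle of radius \<open>exp \<theta>\<close>. The circle is parametrised by \<open>\<sigma>\<close> times the
  angle, the scale on which the integrands below converge.
\<close>

lemma integral_exp_frequency:
  fixes d :: int and \<theta> \<sigma> :: real
  assumes \<sigma>: "0 < \<sigma>"
  shows "has_bochner_integral lborel
           (\<lambda>u. indicator {- pi * \<sigma>..pi * \<sigma>} u *\<^sub>R exp (Complex \<theta> (u / \<sigma>) * of_int d))
           (of_real (2 * pi * \<sigma>) * of_bool (d = 0))"
proof (cases "d = 0")
  case True
  have "(complex_of_real has_vector_derivative 1) (at u within S)" for u S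
    using has_vector_derivative_of_real[OF DERIV_ident, where 'a = complex] by simp
  thus ?thesis
    using has_bochner_integral_FTC_Icc[of "- pi * \<sigma>" "pi * \<sigma>" complex_of_real "\<lambda>_. 1"] \<sigma> True
    by (simp add: algebra_simps)
next
  case False
  define F where "F = (\<lambda>u::real. exp (Complex \<theta> (u / \<sigma>) * of_int d) * (\<sigma> / (\<i> * of_int d)))"
  have Cx: "Complex \<theta> (u / \<sigma>) = \<theta> + \<i> * u / \<sigma>" for u
    by (simp add: complex_eq_iff)
  have der: "(F has_vector_derivative exp (Complex \<theta> (u / \<sigma>) * of_int d)) (at u within S)" for u S
  proof -
    have "((\<lambda>w. exp ((\<theta> + \<i> * w / \<sigma>) * of_int d) * (\<sigma> / (\<i> * of_int d))) has_field_derivative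
        exp ((\<theta> + \<i> * u / \<sigma>) * of_int d)) (at (of_real u))"
      using False \<sigma> by (auto intro!: derivative_eq_intros)
    from has_vector_derivative_real_field[OF this] show ?thesis
      unfolding F_def Cx .
  qed
  have "F (pi * \<sigma>) - F (- pi * \<sigma>) = 0"
  proof -
    have "exp (Complex \<theta> (pi * \<sigma> / \<sigma>) * of_int d) = exp (Complex \<theta> (- pi * \<sigma> / \<sigma>) * of_int d)"
      unfolding exp_eq
      by (rule exI[of _ d]) (use \<sigma> in \<open>simp add: complex_eq_iff\<close>)
    thus ?thesis by (simp add: F_def)
  qed
  moreover have "continuous_on {- pi * \<sigma>..pi * \<sigma>} (\<lambda>u. exp (Complex \<theta> (u / \<sigma>) * of_int d))"
    unfolding Cx using \<sigma> by (intro continuous_intros) auto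
  ultimately show ?thesis
    using has_bochner_integral_FTC_Icc[OF _ der, of "- pi * \<sigma>" "pi * \<sigma>"] \<sigma> False by simp
qed

text \<open>
  If \<open>G\<close> is the generating function of \<open>w\<close> on the circle, then \<open>w j\<close> is an integral of \<open>G u * exp (- z u * j)\<close>. Summed over
  the window \<open>h \<le> j < h + K\<close>, the kernel is a finite geometric series. The window reaches past \<open>N\<close> because
  \<open>N < K\<close>; its length stays free, so that it can later be chosen to make \<open>exp (- z u * K)\<close> negligible, and no infinite
  sum has to be exchanged with the integral.
\<close>

lemma tail_sum_eq_contour_integral:
  fixes w :: "nat \<Rightarrow> real" and \<theta> \<sigma> :: real and z G :: "real \<Rightarrow> complex"
  assumes \<theta>: "0 < \<theta>" and \<sigma>: "0 < \<sigma>" and K: "N < K"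
  defines "z \<equiv> \<lambda>u. Complex \<theta> (u / \<sigma>)"
  assumes G: "\<And>u. (\<Sum>j\<le>N. complex_of_real (w j) * exp (z u) ^ j) = G u"
  shows "has_bochner_integral lborel
           (\<lambda>u. indicator {- pi * \<sigma>..pi * \<sigma>} u *\<^sub>R
              (G u * exp (- z u * of_nat h) * ((1 - exp (- z u * of_nat K)) / (1 - exp (- z u)))))
           (complex_of_real (2 * pi * \<sigma> * (\<Sum>j=h..N. w j)))"
    (is "has_bochner_integral _ ?f ?I")
proof -
  let ?i = "\<lambda>u. indicator {- pi * \<sigma>..pi * \<sigma>} u :: real"
  have "has_bochner_integral lborel
      (\<lambda>u. \<Sum>j\<le>N. \<Sum>l<K. complex_of_real (w j) * (?i u *\<^sub>R exp (z u * of_int (int j - int (h + l)))))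
      (\<Sum>j\<le>N. \<Sum>l<K. complex_of_real (w j) * (complex_of_real (2 * pi * \<sigma>) * of_bool (int j - int (h + l) = 0)))"
    unfolding z_def
    by (intro has_bochner_integral_sum has_bochner_integral_mult_right integral_exp_frequency[OF \<sigma>])
  also have "(\<lambda>u. \<Sum>j\<le>N. \<Sum>l<K. complex_of_real (w j) * (?i u *\<^sub>R exp (z u * of_int (int j - int (h + l))))) = ?f"
  proof
    fix u
    have ne: "exp (- z u) \<noteq> 1"
    proof
      assume "exp (- z u) = 1"
      hence "norm (exp (- z u)) = 1" by simp
      thus False using \<theta> by (simp add: z_def)
    qed
    have "(\<Sum>j\<le>N. \<Sum>l<K. complex_of_real (w j) * (?i u *\<^sub>R exp (z u * of_int (int j - int (h + l)))))
        = (\<Sum>j\<le>N. \<Sum>l<K. ?i u *\<^sub>R ((complex_of_real (w j) * exp (z u) ^ j) * (exp (- z u * of_nat h) * exp (- z u) ^ l)))"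
    proof (intro sum.cong refl)
      fix j l
      have "exp (z u * of_int (int j - int (h + l))) = exp (of_nat j * z u) * (exp (- z u * of_nat h) * exp (of_nat l * (- z u)))"
        by (simp add: algebra_simps flip: exp_add)
      thus "complex_of_real (w j) * (?i u *\<^sub>R exp (z u * of_int (int j - int (h + l))))
          = ?i u *\<^sub>R ((complex_of_real (w j) * exp (z u) ^ j) * (exp (- z u * of_nat h) * exp (- z u) ^ l))"
        by (simp only: exp_of_nat_mult) (simp add: mult_ac)
    qed
    also have "\<dots> = ?i u *\<^sub>R ((\<Sum>j\<le>N. complex_of_real (w j) * exp (z u) ^ j) * (exp (- z u * of_nat h) * (\<Sum>l<K. exp (- z u) ^ l)))"
      by (simp only: flip: scaleR_sum_right sum_distrib_left sum_distrib_right)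
    also have "(\<Sum>l<K. exp (- z u) ^ l) = (1 - exp (- z u * of_nat K)) / (1 - exp (- z u))"
      using ne exp_of_nat2_mult[of "- z u" K] by (simp add: sum_gp_strict)
    finally show "(\<Sum>j\<le>N. \<Sum>l<K. complex_of_real (w j) * (?i u *\<^sub>R exp (z u * of_int (int j - int (h + l))))) = ?f u"
      by (simp add: G mult.assoc)
  qed
  also have "(\<Sum>j\<le>N. \<Sum>l<K. complex_of_real (w j) * (complex_of_real (2 * pi * \<sigma>) * of_bool (int j - int (h + l) = 0))) = ?I"
  proof -
    have "(\<Sum>l<K. of_bool (int j - int (h + l) = 0)) = (of_bool (h \<le> j) :: complex)" if "j \<le> N" for j
    proof (cases "h \<le> j")
      case True
      have "(\<Sum>l<K. of_bool (int j - int (h + l) = 0)) = (\<Sum>l<K. if l = j - h then 1 else (0 :: complex))"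
        using True by (intro sum.cong) auto
      thus ?thesis using True that K by simp
    next
      case False
      thus ?thesis by (intro trans[OF sum.neutral]) auto
    qed
    hence "(\<Sum>j\<le>N. \<Sum>l<K. complex_of_real (w j) * (complex_of_real (2 * pi * \<sigma>) * of_bool (int j - int (h + l) = 0)))
        = (\<Sum>j\<le>N. complex_of_real (w j) * (of_real (2 * pi * \<sigma>) * of_bool (h \<le> j)))"
      by (intro sum.cong refl) (simp flip: sum_distrib_left)
    also have "\<dots> = of_real (2 * pi * \<sigma>) * of_real (\<Sum>j\<in>{j\<in>{..N}. h \<le> j}. w j)"
      unfolding sum.inter_filter[OF finite_atMost] of_real_sum sum_distrib_left
      by (intro sum.cong) auto
    also have "{j\<in>{..N}. h \<le> j} = {h..N}" by auto
    finally show ?thesis by simp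
  qed
  finally show ?thesis .
qed

section \<open>Moderate deviations of sums of independent Bernoulli variables\<close>

lemma gaussian_integral:
  fixes c :: real
  assumes "0 < c"
  shows "has_bochner_integral lborel (\<lambda>u. exp (- (u\<^sup>2 / (2 * c)))) (sqrt (2 * pi * c))"
proof -
  have "has_bochner_integral lborel (\<lambda>u. sqrt (2 * pi * c) * normal_density 0 (sqrt c) u)
      (sqrt (2 * pi * c) * 1)"
    using assms integrable_normal_density[of "sqrt c" 0] integral_normal_density[of "sqrt c" 0]
    by (intro has_bochner_integral_mult_right) (auto simp: has_bochner_integral_iff)
  also have "(\<lambda>u. sqrt (2 * pi * c) * normal_density 0 (sqrt c) u) = (\<lambda>u. exp (- (u\<^sup>2 / (2 * c))))"
    using assms by (auto simp: normal_density_def fun_eq_iff)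
  finally show ?thesis by simp
qed

text \<open>
  Expanding the product leaves a sum over nonempty subsets, bounded termwise by the expansion of
  \<open>\<Prod>i. (1 + norm (f i - 1))\<close>.
\<close>

lemma norm_prod_minus_1_le:
  fixes f :: "'a \<Rightarrow> complex"
  assumes "finite A"
  shows "norm ((\<Prod>i\<in>A. f i) - 1) \<le> exp (\<Sum>i\<in>A. norm (f i - 1)) - 1"
  using assms
proof (induction A)
  case (insert a A)
  let ?P = "\<Prod>i\<in>A. f i" and ?s = "\<Sum>i\<in>A. norm (f i - 1)" and ?d = "norm (f a - 1)"
  have "(\<Prod>i\<in>insert a A. f i) - 1 = (f a - 1) * (?P - 1) + (f a - 1) + (?P - 1)"
    using insert by (simp add: algebra_simps)
  also have "norm \<dots> \<le> ?d * norm (?P - 1) + ?d + norm (?P - 1)"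
    by (intro norm_triangle_mono) (auto simp: norm_mult)
  also have "\<dots> \<le> ?d * (exp ?s - 1) + ?d + (exp ?s - 1)"
    using insert.IH by (intro add_mono mult_left_mono) auto
  also have "\<dots> = (1 + ?d) * exp ?s - 1"
    by (simp add: algebra_simps)
  also have "\<dots> \<le> exp ?d * exp ?s - 1"
    by (intro diff_right_mono mult_right_mono exp_ge_add_one_self) auto
  also have "\<dots> = exp (\<Sum>i\<in>insert a A. norm (f i - 1)) - 1"
    using insert by (simp add: exp_add)
  finally show ?case .
qed simp

lemma tendsto_over_one_minus_exp:
  "((\<lambda>z::complex. z / (1 - exp (- z))) \<longlongrightarrow> 1) (at 0)"
proof -
  have "((\<lambda>z::complex. 1 - exp (- z)) has_field_derivative 1) (at 0)"
    by (auto intro!: derivative_eq_intros)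
  hence "((\<lambda>z::complex. (1 - exp (- z)) / z) \<longlongrightarrow> 1) (at 0)"
    by (simp add: has_field_derivative_iff)
  from tendsto_inverse[OF this] show ?thesis by simp
qed

text \<open>
  Cramer's theorem for sums of independent Bernoulli variables in the range \<open>x\<^sup>3 = o(\<sigma>)\<close>: \<open>w m\<close> is the law
  of the sum, given through its generating function, and the tail above \<open>\<mu> + \<sigma> x\<close> is equivalent to
  \<open>exp (- x\<^sup>2 / 2) / (x sqrt (2 \<pi>))\<close>. The bound \<open>p \<le> 1 / 2\<close> makes the mean at most twice the variance, so that
  the third order error of the cumulant expansion, of size \<open>\<mu> (x / \<sigma>)\<^sup>3\<close>, is a multiple of \<open>x\<^sup>3 / \<sigma>\<close>.
  
  The radius \<open>exp \<theta>\<close> of the contour, \<open>\<theta> = x / \<sigma>\<close>, is the saddle point to first order. The integrand is split into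
  \<open>A\<close>, the generating function against \<open>exp (- z h)\<close>, and \<open>B\<close>, the geometric kernel normalised by \<open>\<theta>\<close>.
  On the scale of the variable \<open>u\<close>, \<open>A\<close> converges to \<open>exp (- u\<^sup>2 / 2)\<close> and \<open>B\<close> to \<open>1\<close>.
\<close>

theorem poisson_binomial_moderate_deviation:
  fixes I :: "nat \<Rightarrow> 'a set" and p :: "nat \<Rightarrow> 'a \<Rightarrow> real"
    and w :: "nat \<Rightarrow> nat \<Rightarrow> real" and N :: "nat \<Rightarrow> nat" and x \<mu> \<sigma> :: "nat \<Rightarrow> real"
  defines "\<mu> \<equiv> \<lambda>m. \<Sum>i\<in>I m. p m i"
    and "\<sigma> \<equiv> \<lambda>m. sqrt (\<Sum>i\<in>I m. p m i * (1 - p m i))"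
  assumes fin: "\<And>m. finite (I m)"
    and p: "\<And>m i. i \<in> I m \<Longrightarrow> 0 \<le> p m i \<and> p m i \<le> 1 / 2"
    and pgf: "\<And>m (z :: complex). (\<Sum>j\<le>N m. w m j * z ^ j) = (\<Prod>i\<in>I m. 1 - p m i + p m i * z)"
    and \<sigma>_pos: "\<And>m. 0 < \<sigma> m"
    and x: "filterlim x at_top sequentially"
    and rate: "(\<lambda>m. x m ^ 3 / \<sigma> m) \<longlonglongrightarrow> 0"
  shows "(\<lambda>m. x m * exp ((x m)\<^sup>2 / 2) * (\<Sum>j | j \<le> N m \<and> \<mu> m + \<sigma> m * x m < real j. w m j))
           \<longlonglongrightarrow> 1 / sqrt (2 * pi)"
proof -
  define V where "V = (\<lambda>m. \<Sum>i\<in>I m. p m i * (1 - p m i))"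
  have V_nonneg: "0 \<le> V m" for m
    unfolding V_def using p by (intro sum_nonneg mult_nonneg_nonneg) force+
  have \<sigma>2: "(\<sigma> m)\<^sup>2 = V m" for m
    using V_nonneg[of m] by (simp add: \<sigma>_def V_def)
  have \<mu>_le: "\<mu> m \<le> 2 * V m" and \<mu>_nonneg: "0 \<le> \<mu> m" for m
  proof -
    show "0 \<le> \<mu> m"
      unfolding \<mu>_def using p by (intro sum_nonneg) auto
    have "p m i \<le> 2 * (p m i * (1 - p m i))" if "i \<in> I m" for i
      using p[OF that] mult_left_mono[of "2 * p m i" 1 "p m i"] by (simp add: algebra_simps)
    thus "\<mu> m \<le> 2 * V m"
      unfolding \<mu>_def V_def sum_distrib_left by (intro sum_mono)
  qed
  define \<theta> where "\<theta> = (\<lambda>m. x m / \<sigma> m)"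
  define z where "z = (\<lambda>m u. Complex (\<theta> m) (u / \<sigma> m))"
  define t where "t = (\<lambda>m. \<mu> m + \<sigma> m * x m)"
  \<comment> \<open>\<open>h\<close> is the least integer above \<open>t\<close>; the window length \<open>K\<close> covers the support and makes \<open>\<theta> K\<close> tend to infinity.\<close>
  define h where "h = (\<lambda>m. nat \<lfloor>t m\<rfloor> + 1)"
  define K where "K = (\<lambda>m. N m + 1 + nat \<lceil>real m / \<theta> m\<rceil>)"
  define G where "G = (\<lambda>m u. \<Prod>i\<in>I m. 1 - p m i + p m i * exp (z m u))"
  define A where "A = (\<lambda>m u. of_real (exp ((x m)\<^sup>2 / 2)) * G m u * exp (- z m u * of_nat (h m)))"
  define B where "B = (\<lambda>m u. of_real (\<theta> m) *
      ((1 - exp (- z m u * of_nat (K m))) / (1 - exp (- z m u))))"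
  define f where "f = (\<lambda>m u. indicator {- pi * \<sigma> m..pi * \<sigma> m} u *\<^sub>R (A m u * B m u))"
  define T where "T = (\<lambda>m. x m * exp ((x m)\<^sup>2 / 2) *
      (\<Sum>j | j \<le> N m \<and> \<mu> m + \<sigma> m * x m < real j. w m j))"

  have x_ge_1: "\<forall>\<^sub>F m in sequentially. 1 \<le> x m"
    using x by (simp add: filterlim_at_top)
  have \<theta>_lim: "\<theta> \<longlonglongrightarrow> 0"
  proof (rule tendsto_sandwich[OF _ _ tendsto_const rate])
    show "\<forall>\<^sub>F m in sequentially. 0 \<le> \<theta> m"
      using x_ge_1 by eventually_elim (use \<sigma>_pos in \<open>simp add: \<theta>_def less_imp_le\<close>)
    show "\<forall>\<^sub>F m in sequentially. \<theta> m \<le> x m ^ 3 / \<sigma> m"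
      using x_ge_1
    proof eventually_elim
      case (elim m)
      thus ?case
        using \<sigma>_pos[of m] power_increasing[of 1 3 "x m"] by (simp add: \<theta>_def divide_right_mono)
    qed
  qed
  have \<theta>_le_1: "\<forall>\<^sub>F m in sequentially. \<theta> m \<le> 1"
    using order_tendstoD(2)[OF \<theta>_lim, of 1] by (auto elim: eventually_mono)
  have z_eq: "z m u = of_real (\<theta> m) * (1 + \<i> * of_real (u / x m))" if "1 \<le> x m" for m u
    using that \<sigma>_pos[of m] by (simp add: z_def \<theta>_def complex_eq_iff)
  have norm_z: "norm (z m u) \<le> (1 + \<bar>u\<bar>) * \<theta> m" if "1 \<le> x m" for m u
  proof -
    have "norm (z m u) \<le> \<bar>\<theta> m\<bar> + \<bar>u / \<sigma> m\<bar>"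
      unfolding z_def by (rule order_trans[OF cmod_le]) simp
    also have "\<bar>u / \<sigma> m\<bar> = \<bar>u\<bar> * 1 / \<sigma> m"
      using \<sigma>_pos[of m] by simp
    also have "\<dots> \<le> \<bar>u\<bar> * x m / \<sigma> m"
      using that \<sigma>_pos[of m] by (intro divide_right_mono mult_left_mono) auto
    finally show ?thesis
      using that \<sigma>_pos[of m] by (simp add: \<theta>_def algebra_simps add_divide_distrib)
  qed
  have z_lim: "(\<lambda>m. z m u) \<longlonglongrightarrow> 0" for u
  proof (rule Lim_null_comparison)
    show "\<forall>\<^sub>F m in sequentially. norm (z m u) \<le> (1 + \<bar>u\<bar>) * \<theta> m"
      using x_ge_1 by eventually_elim (rule norm_z)
    show "(\<lambda>m. (1 + \<bar>u\<bar>) * \<theta> m) \<longlonglongrightarrow> 0"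
      using tendsto_mult_right_zero[OF \<theta>_lim] .
  qed

  have t_h: "\<bar>real (h m) - t m\<bar> \<le> 1" and less_h: "t m < real j \<longleftrightarrow> h m \<le> j" if "1 \<le> x m" for m j
  proof -
    have "0 \<le> t m"
      using \<mu>_nonneg[of m] \<sigma>_pos[of m] that by (simp add: t_def)
    hence "real (h m) = of_int \<lfloor>t m\<rfloor> + 1"
      by (simp add: h_def)
    thus "\<bar>real (h m) - t m\<bar> \<le> 1"
      by linarith
    show "t m < real j \<longleftrightarrow> h m \<le> j"
      unfolding h_def using \<open>0 \<le> t m\<close> by linarith
  qed

  \<comment> \<open>The quadratic exponent of the expansion meets \<open>exp (- z t)\<close>: since \<open>\<sigma> z = x + \<i> u\<close>, the square is completed and only \<open>- u\<^sup>2 / 2\<close> survives.\<close>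
  have A_lim: "(\<lambda>m. A m u) \<longlonglongrightarrow> of_real (exp (- (u\<^sup>2 / 2)))" for u
  proof -
    define H where "H = (\<lambda>m i. (1 - p m i + p m i * exp (z m u)) *
        exp (- (p m i * z m u + p m i * (1 - p m i) * (z m u)\<^sup>2 / 2)))"
    have "(\<lambda>m. (\<Prod>i\<in>I m. H m i) - 1) \<longlonglongrightarrow> 0"
    proof (rule Lim_null_comparison)
      have "(\<lambda>m. norm (z m u)) \<longlonglongrightarrow> 0"
        using z_lim by (rule tendsto_norm_zero)
      hence "\<forall>\<^sub>F m in sequentially. norm (z m u) < 1"
        by (rule order_tendstoD) simp
      thus "\<forall>\<^sub>F m in sequentially. norm ((\<Prod>i\<in>I m. H m i) - 1)
          \<le> exp (256 * (1 + \<bar>u\<bar>) ^ 3 * (x m ^ 3 / \<sigma> m)) - 1"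
        using x_ge_1
      proof eventually_elim
        case (elim m)
        have 1: "norm ((\<Prod>i\<in>I m. H m i) - 1) \<le> exp (\<Sum>i\<in>I m. norm (H m i - 1)) - 1"
          by (rule norm_prod_minus_1_le[OF fin])
        have "(\<Sum>i\<in>I m. norm (H m i - 1)) \<le> (\<Sum>i\<in>I m. 128 * p m i * norm (z m u) ^ 3)"
        proof (rule sum_mono)
          fix i assume "i \<in> I m"
          thus "norm (H m i - 1) \<le> 128 * p m i * norm (z m u) ^ 3"
            unfolding H_def using p[of i m] elim by (intro bernoulli_mgf_approx) auto
        qed
        also have "\<dots> = 128 * \<mu> m * norm (z m u) ^ 3"
          by (simp add: \<mu>_def sum_distrib_left sum_distrib_right)
        also have "\<dots> \<le> 128 * (2 * V m) * ((1 + \<bar>u\<bar>) * \<theta> m) ^ 3"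
          using \<mu>_le norm_z elim V_nonneg by (intro mult_mono power_mono mult_left_mono) auto
        also have "\<dots> = 256 * (1 + \<bar>u\<bar>) ^ 3 * (x m ^ 3 / \<sigma> m)"
          using \<sigma>_pos[of m] unfolding \<sigma>2[symmetric] \<theta>_def
          by (simp add: power_mult_distrib power_divide power2_eq_square power3_eq_cube)
        finally have "exp (\<Sum>i\<in>I m. norm (H m i - 1)) - 1 \<le> exp (256 * (1 + \<bar>u\<bar>) ^ 3 * (x m ^ 3 / \<sigma> m)) - 1"
          by simp
        with 1 show ?case
          by (rule order_trans)
      qed
      have "(\<lambda>m. exp (256 * (1 + \<bar>u\<bar>) ^ 3 * (x m ^ 3 / \<sigma> m)) - 1) \<longlonglongrightarrow> exp (256 * (1 + \<bar>u\<bar>) ^ 3 * 0) - 1"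
        by (intro tendsto_intros rate)
      thus "(\<lambda>m. exp (256 * (1 + \<bar>u\<bar>) ^ 3 * (x m ^ 3 / \<sigma> m)) - 1) \<longlonglongrightarrow> 0"
        by simp
    qed
    hence H_lim: "(\<lambda>m. \<Prod>i\<in>I m. H m i) \<longlonglongrightarrow> 1"
      by (simp add: LIM_zero_iff)
    have "(\<lambda>m. z m u * (real (h m) - t m)) \<longlonglongrightarrow> 0"
    proof (rule Lim_null_comparison)
      show "\<forall>\<^sub>F m in sequentially. norm (z m u * complex_of_real (real (h m) - t m)) \<le> norm (z m u)"
        using x_ge_1
      proof eventually_elim
        case (elim m)
        show ?case
          unfolding norm_mult norm_of_real
          using mult_left_mono[OF t_h[OF elim], of "norm (z m u)"] by simp
      qed
      show "(\<lambda>m. norm (z m u)) \<longlonglongrightarrow> 0"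
        using z_lim by (rule tendsto_norm_zero)
    qed
    hence "(\<lambda>m. (\<Prod>i\<in>I m. H m i) * exp (of_real (- (u\<^sup>2 / 2)) - z m u * (real (h m) - t m)))
        \<longlonglongrightarrow> 1 * exp (of_real (- (u\<^sup>2 / 2)) - 0)"
      by (intro tendsto_intros H_lim)
    moreover have "A m u = (\<Prod>i\<in>I m. H m i) * exp (of_real (- (u\<^sup>2 / 2)) - z m u * (real (h m) - t m))" for m
    proof -
      have P: "(\<Prod>i\<in>I m. H m i) = G m u * exp (- (\<mu> m * z m u + V m * (z m u)\<^sup>2 / 2))"
      proof -
        have "(\<Sum>i\<in>I m. - (p m i * z m u + p m i * (1 - p m i) * (z m u)\<^sup>2 / 2))
            = - (\<mu> m * z m u + V m * (z m u)\<^sup>2 / 2)"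
          by (simp add: \<mu>_def V_def sum_negf sum_subtractf sum_distrib_right sum_divide_distrib)
        thus ?thesis
          unfolding H_def G_def prod.distrib by (simp only: flip: exp_sum[OF fin])
      qed
      have Q: "complex_of_real ((x m)\<^sup>2 / 2) - z m u * of_nat (h m) = - (\<mu> m * z m u + V m * (z m u)\<^sup>2 / 2) +
          (of_real (- (u\<^sup>2 / 2)) - z m u * (real (h m) - t m))"
      proof -
        have sz: "\<sigma> m * z m u = x m + \<i> * u"
          using \<sigma>_pos[of m] by (simp add: z_def \<theta>_def complex_eq_iff)
        have 1: "V m * (z m u)\<^sup>2 = (x m + \<i> * u)\<^sup>2"
          unfolding sz[symmetric] \<sigma>2[symmetric] by (simp add: power_mult_distrib)
        have "z m u * t m = \<mu> m * z m u + x m * (\<sigma> m * z m u)"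
          by (simp add: t_def algebra_simps)
        hence 2: "z m u * t m = \<mu> m * z m u + x m * (x m + \<i> * u)"
          unfolding sz .
        have 3: "z m u * (real (h m) - t m) = z m u * h m - (\<mu> m * z m u + x m * (x m + \<i> * u))"
          unfolding 2[symmetric] by (simp add: algebra_simps)
        show ?thesis
          unfolding 1 3 by (simp add: power2_eq_square field_simps)
      qed
      have "A m u = G m u * exp (complex_of_real ((x m)\<^sup>2 / 2) - z m u * of_nat (h m))"
        by (simp only: A_def exp_of_real diff_conv_add_uminus exp_add mult_minus_left mult_minus_right mult_ac)
      thus ?thesis
        unfolding P Q exp_add by (simp only: mult.assoc)
    qed
    ultimately show ?thesis
      by (simp flip: exp_of_real)
  qed

  \<comment> \<open>\<open>\<theta> / (1 - exp (- z))\<close> tends to \<open>1\<close> because \<open>z \<sim> \<theta>\<close>: the imaginary part \<open>u / \<sigma>\<close> is smaller than \<open>\<theta>\<close> by the factor \<open>x\<close>.\<close>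
  have B_lim: "(\<lambda>m. B m u) \<longlonglongrightarrow> 1" for u
  proof -
    have "filterlim (\<lambda>m. z m u) (at 0) sequentially"
      unfolding filterlim_at
    proof
      show "\<forall>\<^sub>F m in sequentially. z m u \<in> UNIV \<and> z m u \<noteq> 0"
        using x_ge_1
      proof eventually_elim
        case (elim m)
        hence "\<theta> m \<noteq> 0"
          using \<sigma>_pos[of m] by (simp add: \<theta>_def)
        thus ?case
          by (simp add: z_def complex_eq_iff)
      qed
    qed (rule z_lim)
    hence 1: "(\<lambda>m. z m u / (1 - exp (- z m u))) \<longlonglongrightarrow> 1"
      by (rule filterlim_compose[OF tendsto_over_one_minus_exp])
    have "(\<lambda>m. u / x m) \<longlonglongrightarrow> 0"
      by (rule tendsto_divide_0[OF tendsto_const filterlim_at_top_imp_at_infinity[OF x]])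
    hence 2: "(\<lambda>m. 1 + \<i> * of_real (u / x m)) \<longlonglongrightarrow> 1 + \<i> * of_real 0"
      by (intro tendsto_intros)
    have 3: "(\<lambda>m. 1 - exp (- z m u * of_nat (K m))) \<longlonglongrightarrow> 1 - 0"
    proof (rule tendsto_diff[OF tendsto_const], rule Lim_null_comparison)
      show "\<forall>\<^sub>F m in sequentially. norm (exp (- z m u * of_nat (K m))) \<le> exp (- real m)"
        using x_ge_1
      proof eventually_elim
        case (elim m)
        have \<theta>: "0 < \<theta> m"
          using elim \<sigma>_pos[of m] by (simp add: \<theta>_def)
        have "real m = \<theta> m * (real m / \<theta> m)"
          using \<theta> by simp
        also have "\<dots> \<le> \<theta> m * real (K m)"
          unfolding K_def using \<theta> by (intro mult_left_mono) linarith+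
        finally show ?case
          by (simp add: z_def)
      qed
      show "(\<lambda>m. exp (- real m)) \<longlonglongrightarrow> 0"
        by (intro filterlim_compose[OF exp_at_bot] filterlim_compose[OF filterlim_uminus_at_bot_at_top]
              filterlim_real_sequentially)
    qed
    have "(\<lambda>m. z m u / (1 - exp (- z m u)) / (1 + \<i> * of_real (u / x m)) * (1 - exp (- z m u * of_nat (K m))))
        \<longlonglongrightarrow> 1 / (1 + \<i> * of_real 0) * (1 - 0)"
      by (intro tendsto_intros 1 2 3) simp
    moreover have "\<forall>\<^sub>F m in sequentially. z m u / (1 - exp (- z m u)) / (1 + \<i> * of_real (u / x m)) *
        (1 - exp (- z m u * of_nat (K m))) = B m u"
      using x_ge_1
    proof eventually_elim
      case (elim m)
      have "Re (1 + \<i> * of_real (u / x m)) \<noteq> 0"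
        by simp
      hence "1 + \<i> * of_real (u / x m) \<noteq> 0"
        by (metis zero_complex.sel(1))
      hence "z m u / (1 + \<i> * of_real (u / x m)) = of_real (\<theta> m)"
        by (subst z_eq[OF elim]) (rule nonzero_mult_div_cancel_right)
      thus ?case
        unfolding B_def by (metis (no_types, lifting) times_divide_eq_left divide_divide_eq_left mult.commute
            times_divide_eq_right)
    qed
    ultimately show ?thesis
      using Lim_transform_eventually by fastforce
  qed

  \<comment> \<open>The two bounds that dominate the integrand, uniformly in \<open>m\<close>.\<close>
  have A_le: "norm (A m u) \<le> norm (A m 0) * exp (- (u\<^sup>2 / 24))"
    if m: "1 \<le> x m" "\<theta> m \<le> 1" and u: "\<bar>u\<bar> \<le> pi * \<sigma> m" for m u
  proof -
    have \<theta>: "0 \<le> \<theta> m"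
      using m \<sigma>_pos[of m] by (simp add: \<theta>_def)
    have "norm (G m u) = (\<Prod>i\<in>I m. norm (1 - p m i + p m i * exp (z m u)))"
      by (simp add: G_def prod_norm)
    also have "\<dots> \<le> (\<Prod>i\<in>I m. (1 - p m i + p m i * exp (\<theta> m)) *
        exp (- (p m i * (1 - p m i) * exp (- \<theta> m) * (1 - cos (u / \<sigma> m)))))"
    proof (intro prod_mono conjI norm_ge_zero)
      fix i assume i: "i \<in> I m"
      show "norm (1 - p m i + p m i * exp (z m u)) \<le> (1 - p m i + p m i * exp (\<theta> m)) *
        exp (- (p m i * (1 - p m i) * exp (- \<theta> m) * (1 - cos (u / \<sigma> m))))"
        unfolding z_def by (rule norm_bernoulli_mgf_le) (use p[OF i] \<theta> in auto)
    qed
    also have "\<dots> = (\<Prod>i\<in>I m. 1 - p m i + p m i * exp (\<theta> m)) *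
        exp (- (V m * exp (- \<theta> m) * (1 - cos (u / \<sigma> m))))"
      by (simp add: prod.distrib V_def sum_distrib_right exp_sum fin flip: sum_negf)
    also have "(\<Prod>i\<in>I m. 1 - p m i + p m i * exp (\<theta> m)) = norm (G m 0)"
    proof -
      have "norm (1 - p m i + p m i * exp (z m 0)) = 1 - p m i + p m i * exp (\<theta> m)" if "i \<in> I m" for i
      proof -
        have "1 - p m i + p m i * exp (z m 0) = complex_of_real (1 - p m i + p m i * exp (\<theta> m))"
          by (simp add: z_def flip: exp_of_real complex_of_real_def)
        hence "norm (1 - p m i + p m i * exp (z m 0)) = \<bar>1 - p m i + p m i * exp (\<theta> m)\<bar>"
          by (metis norm_of_real)
        thus ?thesis
          using p[OF that] by (simp add: add_nonneg_nonneg)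
      qed
      thus ?thesis
        by (simp add: G_def flip: prod_norm)
    qed
    finally have "norm (G m u) \<le> norm (G m 0) * exp (- (V m * exp (- \<theta> m) * (1 - cos (u / \<sigma> m))))" .
    \<comment> \<open>The constant is \<open>24 = 3 * 8\<close>, from \<open>exp (- \<theta>) \<ge> 1 / 3\<close> and \<open>1 - cos s \<ge> s\<^sup>2 / 8\<close>.\<close>
    moreover have "u\<^sup>2 / 24 \<le> V m * exp (- \<theta> m) * (1 - cos (u / \<sigma> m))"
    proof -
      have "\<bar>u / \<sigma> m\<bar> \<le> pi"
        using u \<sigma>_pos[of m] by (simp add: field_simps)
      hence "(u / \<sigma> m)\<^sup>2 / 8 \<le> 1 - cos (u / \<sigma> m)"
        by (rule one_minus_cos_ge)
      moreover have "1 / 3 \<le> exp (- \<theta> m)"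
      proof -
        have "exp (\<theta> m) \<le> exp 1"
          using m by simp
        also have "exp 1 \<le> (3 :: real)"
          using e_less_272 by simp
        finally show ?thesis
          by (simp add: exp_minus field_simps)
      qed
      ultimately have "V m * (1 / 3) * ((u / \<sigma> m)\<^sup>2 / 8) \<le> V m * exp (- \<theta> m) * (1 - cos (u / \<sigma> m))"
        using V_nonneg[of m] by (intro mult_mono mult_nonneg_nonneg) auto
      moreover have "V m * (1 / 3) * ((u / \<sigma> m)\<^sup>2 / 8) = u\<^sup>2 / 24"
        using \<sigma>_pos[of m] unfolding \<sigma>2[symmetric] by (simp add: power_divide)
      ultimately show ?thesis by simp
    qed
    ultimately have "norm (G m u) \<le> norm (G m 0) * exp (- (u\<^sup>2 / 24))"
      by (elim order_trans) (intro mult_left_mono, auto)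
    hence "exp ((x m)\<^sup>2 / 2) * norm (G m u) * exp (- \<theta> m * h m)
        \<le> exp ((x m)\<^sup>2 / 2) * (norm (G m 0) * exp (- (u\<^sup>2 / 24))) * exp (- \<theta> m * h m)"
      by (intro mult_right_mono mult_left_mono) auto
    thus ?thesis
      by (simp add: A_def norm_mult z_def mult_ac)
  qed

  have B_le: "norm (B m u) \<le> 4" if m: "1 \<le> x m" "\<theta> m \<le> 1" for m u
  proof -
    have \<theta>: "0 < \<theta> m"
      using m \<sigma>_pos[of m] by (simp add: \<theta>_def)
    have "exp (- \<theta> m) * (1 + \<theta> m) \<le> exp (- \<theta> m) * exp (\<theta> m)"
      by (intro mult_left_mono exp_ge_add_one_self) auto
    hence "exp (- \<theta> m) \<le> 1 / (1 + \<theta> m)"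
      using \<theta> by (simp add: field_simps exp_minus)
    also have "\<dots> \<le> 1 - \<theta> m / 2"
      using \<theta> m mult_left_mono[of "\<theta> m" 1 "\<theta> m"] by (simp add: field_simps)
    finally have "\<theta> m / 2 \<le> 1 - exp (- \<theta> m)"
      by simp
    also have "\<dots> \<le> norm (1 - exp (- z m u))"
      using norm_triangle_ineq2[of 1 "exp (- z m u)"] by (simp add: z_def)
    finally have 1: "\<theta> m / 2 \<le> norm (1 - exp (- z m u))" .
    have "norm (1 - exp (- z m u * of_nat (K m))) \<le> norm (1 :: complex) + norm (exp (- z m u * of_nat (K m)))"
      by (rule norm_triangle_ineq4)
    also have "\<dots> \<le> 2"
      using \<theta> by (simp add: z_def)
    finally have "norm (1 - exp (- z m u * of_nat (K m))) / norm (1 - exp (- z m u)) \<le> 2 / (\<theta> m / 2)"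
      using 1 \<theta> by (intro frac_le) auto
    hence "\<theta> m * (norm (1 - exp (- z m u * of_nat (K m))) / norm (1 - exp (- z m u))) \<le> \<theta> m * (2 / (\<theta> m / 2))"
      using \<theta> by (intro mult_left_mono) auto
    thus ?thesis
      using \<theta> by (simp add: B_def norm_mult norm_divide)
  qed

  \<comment> \<open>The case \<open>u = 0\<close> of the limit of \<open>A\<close> also bounds the factor \<open>norm (A m 0)\<close> of the dominating function.\<close>
  have "(\<lambda>m. norm (A m 0)) \<longlonglongrightarrow> norm (complex_of_real (exp (- (0\<^sup>2 / 2))))"
    by (intro tendsto_norm A_lim)
  hence "\<forall>\<^sub>F m in sequentially. norm (A m 0) < 2"
    by (rule order_tendstoD) simp
  hence A0_le: "\<forall>\<^sub>F m in sequentially. norm (A m 0) \<le> 2"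
    by eventually_elim simp
  obtain m0 where m0: "\<And>m. m0 \<le> m \<Longrightarrow> 1 \<le> x m \<and> \<theta> m \<le> 1 \<and> norm (A m 0) \<le> 2"
    using eventually_conj[OF x_ge_1 eventually_conj[OF \<theta>_le_1 A0_le]]
    unfolding eventually_sequentially by blast

  have f_int: "has_bochner_integral lborel (f m) (complex_of_real (2 * pi * T m))" if "m0 \<le> m" for m
  proof -
    have m: "1 \<le> x m" "0 < \<theta> m"
      using m0[OF that] \<sigma>_pos[of m] by (auto simp: \<theta>_def)
    have int: "has_bochner_integral lborel
        (\<lambda>u. of_real (exp ((x m)\<^sup>2 / 2) * \<theta> m) * (indicator {- pi * \<sigma> m..pi * \<sigma> m} u *\<^sub>R
           (G m u * exp (- z m u * of_nat (h m)) * ((1 - exp (- z m u * of_nat (K m))) / (1 - exp (- z m u))))))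
        (complex_of_real (exp ((x m)\<^sup>2 / 2) * \<theta> m) * complex_of_real (2 * pi * \<sigma> m * (\<Sum>j=h m..N m. w m j)))"
      unfolding z_def
    proof (intro has_bochner_integral_mult_right tail_sum_eq_contour_integral)
      show "(\<Sum>j\<le>N m. complex_of_real (w m j) * exp (Complex (\<theta> m) (u / \<sigma> m)) ^ j) = G m u" for u
        unfolding G_def z_def by (rule pgf)
    qed (use m \<sigma>_pos in \<open>auto simp: K_def\<close>)
    have f_eq: "(\<lambda>u. of_real (exp ((x m)\<^sup>2 / 2) * \<theta> m) * (indicator {- pi * \<sigma> m..pi * \<sigma> m} u *\<^sub>R
           (G m u * exp (- z m u * of_nat (h m)) * ((1 - exp (- z m u * of_nat (K m))) / (1 - exp (- z m u))))))
        = f m"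
    proof -
      have "complex_of_real (e * r) * (i *\<^sub>R (g * c * q)) = i *\<^sub>R (of_real e * g * c * (of_real r * q))"
        for e r i g c q
        by (simp add: mult_ac)
      thus ?thesis
        unfolding f_def A_def B_def by (intro ext)
    qed
    have T_eq: "complex_of_real (exp ((x m)\<^sup>2 / 2) * \<theta> m) * complex_of_real (2 * pi * \<sigma> m * (\<Sum>j=h m..N m. w m j))
        = complex_of_real (2 * pi * T m)"
    proof -
      have less: "\<mu> m + \<sigma> m * x m < real j \<longleftrightarrow> h m \<le> j" for j
        using less_h[OF m(1)] by (simp only: t_def)
      have "{j. j \<le> N m \<and> \<mu> m + \<sigma> m * x m < real j} = {h m..N m}"
        unfolding less by auto
      hence "exp ((x m)\<^sup>2 / 2) * \<theta> m * (2 * pi * \<sigma> m * (\<Sum>j=h m..N m. w m j)) = 2 * pi * T m"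
        using \<sigma>_pos[of m] by (simp add: T_def \<theta>_def)
      thus ?thesis
        unfolding of_real_mult[symmetric] by (rule arg_cong)
    qed
    show ?thesis
      using int unfolding f_eq T_eq .
  qed

  define g where "g = (\<lambda>u::real. complex_of_real (exp (- (u\<^sup>2 / 2))))"
  have "(\<lambda>m. integral\<^sup>L lborel (f (m + m0))) \<longlonglongrightarrow> integral\<^sup>L lborel g"
  proof (rule integral_dominated_convergence)
    show "g \<in> borel_measurable lborel"
      unfolding g_def by measurable
    show "f (m + m0) \<in> borel_measurable lborel" for m
      using f_int[of "m + m0"] borel_measurable_integrable[of lborel "f (m + m0)"]
      by (simp add: has_bochner_integral_iff)
    show "integrable lborel (\<lambda>u::real. 8 * exp (- (u\<^sup>2 / (2 * 12))))"
      using gaussian_integral[of 12] by (intro integrable_mult_right) (simp add: has_bochner_integral_iff)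
    show "AE u in lborel. norm (f (m + m0) u) \<le> 8 * exp (- (u\<^sup>2 / (2 * 12)))" for m
    proof (intro AE_I2)
      fix u :: real
      show "norm (f (m + m0) u) \<le> 8 * exp (- (u\<^sup>2 / (2 * 12)))"
      proof (cases "\<bar>u\<bar> \<le> pi * \<sigma> (m + m0)")
        case True
        have "norm (A (m + m0) u * B (m + m0) u) \<le> (2 * exp (- (u\<^sup>2 / 24))) * 4"
          unfolding norm_mult using m0[of "m + m0"] A_le[of "m + m0" u] True B_le[of "m + m0" u]
          by (intro mult_mono order_trans[OF A_le] mult_right_mono) auto
        thus ?thesis
          by (simp add: f_def indicator_def)
      next
        case False
        thus ?thesis
          by (auto simp: f_def indicator_def)
      qed
    qed
    show "AE u in lborel. (\<lambda>m. f (m + m0) u) \<longlonglongrightarrow> g u"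
    proof (intro AE_I2 LIMSEQ_ignore_initial_segment)
      fix u :: real
      have "(\<lambda>m. A m u * B m u) \<longlonglongrightarrow> g u * 1"
        unfolding g_def by (intro tendsto_mult A_lim B_lim)
      moreover have "\<forall>\<^sub>F m in sequentially. A m u * B m u = f m u"
      proof -
        have "(\<lambda>m. \<bar>u\<bar> * \<theta> m) \<longlonglongrightarrow> 0"
          using tendsto_mult_right_zero[OF \<theta>_lim] .
        hence "\<forall>\<^sub>F m in sequentially. \<bar>u\<bar> * \<theta> m < 1"
          by (rule order_tendstoD) simp
        thus ?thesis
          using x_ge_1
        proof eventually_elim
          case (elim m)
          have "\<bar>u\<bar> * 1 \<le> \<bar>u\<bar> * x m"
            using elim by (intro mult_left_mono) auto
          also have "\<dots> < \<sigma> m"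
            using elim \<sigma>_pos[of m] by (simp add: \<theta>_def field_simps)
          also have "\<dots> \<le> pi * \<sigma> m"
            using pi_gt3 \<sigma>_pos[of m] by simp
          finally show ?case
            by (auto simp: f_def indicator_def)
        qed
      qed
      ultimately show "(\<lambda>m. f m u) \<longlonglongrightarrow> g u"
        using Lim_transform_eventually by fastforce
    qed
  qed
  also have "(\<lambda>m. integral\<^sup>L lborel (f (m + m0))) = (\<lambda>m. complex_of_real (2 * pi * T (m + m0)))"
    using f_int by (simp add: has_bochner_integral_iff)
  also have "integral\<^sup>L lborel g = complex_of_real (sqrt (2 * pi))"
    using gaussian_integral[of 1] by (simp add: g_def has_bochner_integral_iff)
  finally have "(\<lambda>m. 2 * pi * T (m + m0)) \<longlonglongrightarrow> sqrt (2 * pi)"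
    by (simp only: tendsto_of_real_iff)
  hence "(\<lambda>m. 2 * pi * T (m + m0) / (2 * pi)) \<longlonglongrightarrow> sqrt (2 * pi) / (2 * pi)"
    by (intro tendsto_intros) auto
  hence "(\<lambda>m. T (m + m0)) \<longlonglongrightarrow> 1 / sqrt (2 * pi)"
    by (simp add: sqrt_divide_self_eq inverse_eq_divide)
  thus ?thesis
    unfolding T_def by (rule LIMSEQ_offset)
qed

section \<open>Poisson limits from factorial moments\<close>

text \<open>
  The sign \<open>(-1) ^ R\<close> on the right is the source of the Bonferroni inequalities: for even \<open>R\<close> the partial sum dominates
  the indicator of \<open>n = 0\<close>, for odd \<open>R\<close> it is dominated by it.
\<close>

lemma alternating_binomial_partial_sum:
  "(\<Sum>r\<le>R. (-1) ^ r * real (n choose r)) = (if n = 0 then 1 else (-1) ^ R * real (n - 1 choose R))"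
proof (cases n)
  case 0
  have "(\<Sum>r\<le>R. (-1) ^ r * real (0 choose r)) = (\<Sum>r\<le>R. if r = 0 then 1 else 0)"
    by (intro sum.cong) auto
  thus ?thesis
    using 0 by simp
next
  case (Suc k)
  have "(\<Sum>r\<le>R. (-1) ^ r * real (n choose r)) = (\<Sum>r\<le>R. (real n gchoose r) * (-1) ^ r)"
    by (simp add: binomial_gbinomial mult.commute)
  also have "\<dots> = (-1) ^ R * (real n - 1 gchoose R)"
    by (rule gbinomial_sum_lower_neg)
  also have "real n - 1 = real (n - 1)"
    using Suc by simp
  finally show ?thesis
    using Suc by (simp add: binomial_gbinomial)
qed

text \<open>
  If \<open>N\<close> is the number of events that occur, this is the expectation of \<open>N choose r\<close>, the factorial moment of order
  \<open>r\<close> divided by \<open>fact r\<close>.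
\<close>

definition factorial_moment :: "'a pmf \<Rightarrow> 'i set \<Rightarrow> ('i \<Rightarrow> 'a set) \<Rightarrow> nat \<Rightarrow> real" where
  "factorial_moment D I E r = (\<Sum>A | A \<subseteq> I \<and> card A = r. measure_pmf.prob D (\<Inter>i\<in>A. E i))"

text \<open>
  With \<open>N\<close> the number of events that occur, these are the expectations of the two pointwise inequalities between the
  indicator of \<open>N = 0\<close> and the alternating sums of \<open>N choose r\<close>.
\<close>

lemma bonferroni:
  fixes D :: "'a pmf" and E :: "'i \<Rightarrow> 'a set"
  assumes fin: "finite I"
  defines "S \<equiv> \<lambda>R. \<Sum>r\<le>R. (-1) ^ r * factorial_moment D I E r"
  shows "even R \<Longrightarrow> measure_pmf.prob D {x. \<forall>i\<in>I. x \<notin> E i} \<le> S R"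
    and "odd R \<Longrightarrow> S R \<le> measure_pmf.prob D {x. \<forall>i\<in>I. x \<notin> E i}"
proof -
  define N where "N = (\<lambda>x. card {i\<in>I. x \<in> E i})"
  have int: "integrable D (\<lambda>x. indicator X x :: real)" for X
    by (rule measure_pmf.integrable_const_bound[where B = 1]) auto
  have sub: "finite {A. A \<subseteq> I \<and> card A = r}" for r
    using fin by simp
  have N_choose: "real (N x choose r) = (\<Sum>A | A \<subseteq> I \<and> card A = r. indicator (\<Inter>i\<in>A. E i) x)" for x r
  proof -
    have "N x choose r = card {A. A \<subseteq> {i\<in>I. x \<in> E i} \<and> card A = r}"
      unfolding N_def using fin by (simp add: n_subsets)
    also have "{A. A \<subseteq> {i\<in>I. x \<in> E i} \<and> card A = r} = {A\<in>{A. A \<subseteq> I \<and> card A = r}. x \<in> (\<Inter>i\<in>A. E i)}"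
      by auto
    also have "real (card \<dots>) = (\<Sum>A | A \<subseteq> I \<and> card A = r. indicator (\<Inter>i\<in>A. E i) x)"
      using sub by (simp add: indicator_def sum.If_cases Int_def conj_commute)
    finally show ?thesis .
  qed
  have S: "has_bochner_integral D (\<lambda>x. \<Sum>r\<le>R. (-1) ^ r * real (N x choose r)) (S R)" for R
    unfolding S_def factorial_moment_def N_choose
    using int by (intro has_bochner_integral_sum has_bochner_integral_mult_right)
      (simp add: has_bochner_integral_iff)
  have P: "has_bochner_integral D (\<lambda>x. of_bool (N x = 0)) (measure_pmf.prob D {x. \<forall>i\<in>I. x \<notin> E i})"
  proof -
    have "of_bool (N x = 0) = (indicator {x. \<forall>i\<in>I. x \<notin> E i} x :: real)" for x
      using fin by (auto simp: N_def indicator_def)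
    thus ?thesis
      using int by (simp add: has_bochner_integral_iff)
  qed
  have P_eq: "integral\<^sup>L D (\<lambda>x. of_bool (N x = 0)) = measure_pmf.prob D {x. \<forall>i\<in>I. x \<notin> E i}"
    and S_eq: "integral\<^sup>L D (\<lambda>x. \<Sum>r\<le>R. (-1) ^ r * real (N x choose r)) = S R" for R
    using P S[of R] by (simp_all add: has_bochner_integral_iff)
  have P_int: "integrable D (\<lambda>x. of_bool (N x = 0) :: real)"
    and S_int: "integrable D (\<lambda>x. \<Sum>r\<le>R. (-1) ^ r * real (N x choose r))" for R
    using P S[of R] by (simp_all add: has_bochner_integral_iff)
  show "measure_pmf.prob D {x. \<forall>i\<in>I. x \<notin> E i} \<le> S R" if "even R"
    unfolding P_eq[symmetric] S_eq[symmetric]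
    by (intro integral_mono P_int S_int) (use that in \<open>simp add: alternating_binomial_partial_sum\<close>)
  show "S R \<le> measure_pmf.prob D {x. \<forall>i\<in>I. x \<notin> E i}" if "odd R"
    unfolding P_eq[symmetric] S_eq[symmetric]
    by (intro integral_mono P_int S_int) (use that in \<open>simp add: alternating_binomial_partial_sum\<close>)
qed

text \<open>
  By the Bonferroni inequalities the probability is squeezed between partial sums of odd and even length, which for a fixed
  length converge to partial sums of the exponential series at \<open>- \<mu>\<close>. A long enough partial sum is as close to
  \<open>exp (- \<mu>)\<close> as required.
\<close>

lemma prob_no_event_tendsto_poisson:
  fixes D :: "nat \<Rightarrow> 'a pmf" and I :: "nat \<Rightarrow> 'i set" and E :: "nat \<Rightarrow> 'i \<Rightarrow> 'a set"
  assumes fin: "\<And>m. finite (I m)"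
    and moments: "\<And>r. (\<lambda>m. factorial_moment (D m) (I m) (E m) r) \<longlonglongrightarrow> \<mu> ^ r / fact r"
  shows "(\<lambda>m. measure_pmf.prob (D m) {x. \<forall>i\<in>I m. x \<notin> E m i}) \<longlonglongrightarrow> exp (- \<mu>)"
proof -
  define S where "S = (\<lambda>R m. \<Sum>r\<le>R. (-1) ^ r * factorial_moment (D m) (I m) (E m) r)"
  define T where "T = (\<lambda>R. \<Sum>r\<le>R. (- \<mu>) ^ r / fact r)"
  have T_lim: "T \<longlonglongrightarrow> exp (- \<mu>)"
    using exp_converges[of "- \<mu>"] unfolding T_def sums_def_le by (simp add: divide_inverse mult.commute)
  have S_lim: "(\<lambda>m. S R m) \<longlonglongrightarrow> T R" for R
  proof -
    have "(\<lambda>m. S R m) \<longlonglongrightarrow> (\<Sum>r\<le>R. (-1) ^ r * (\<mu> ^ r / fact r))"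
      unfolding S_def by (intro tendsto_intros moments)
    thus ?thesis
      by (simp add: T_def power_minus[of \<mu>])
  qed
  have even: "filterlim (\<lambda>R::nat. 2 * R) at_top sequentially"
    and odd: "filterlim (\<lambda>R::nat. 2 * R + 1) at_top sequentially"
    by (auto intro!: filterlim_subseq simp: strict_mono_def)
  show ?thesis
  proof (rule order_tendstoI)
    fix c assume "c < exp (- \<mu>)"
    hence "\<forall>\<^sub>F R in sequentially. c < T (2 * R + 1)"
      using order_tendstoD(1)[OF filterlim_compose[OF T_lim odd]] by simp
    then obtain R where "c < T (2 * R + 1)"
      by (auto simp: eventually_sequentially)
    from order_tendstoD(1)[OF S_lim this]
    show "\<forall>\<^sub>F m in sequentially. c < measure_pmf.prob (D m) {x. \<forall>i\<in>I m. x \<notin> E m i}"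
    proof eventually_elim
      case (elim m)
      thus ?case
        using bonferroni(2)[OF fin[of m], of "2 * R + 1" "D m" "E m"] by (simp add: S_def)
    qed
  next
    fix c assume "exp (- \<mu>) < c"
    hence "\<forall>\<^sub>F R in sequentially. T (2 * R) < c"
      using order_tendstoD(2)[OF filterlim_compose[OF T_lim even]] by simp
    then obtain R where "T (2 * R) < c"
      by (auto simp: eventually_sequentially)
    from order_tendstoD(2)[OF S_lim this]
    show "\<forall>\<^sub>F m in sequentially. measure_pmf.prob (D m) {x. \<forall>i\<in>I m. x \<notin> E m i} < c"
    proof eventually_elim
      case (elim m)
      thus ?case
        using bonferroni(1)[OF fin[of m], of "2 * R" "D m" "E m"] by (simp add: S_def)
    qed
  qed
qed

lemma binomial_over_power_tendsto:
  "(\<lambda>n. real (n choose r) / real n ^ r) \<longlonglongrightarrow> 1 / fact r"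
proof (induction r)
  case 0
  thus ?case by simp
next
  case (Suc r)
  have "(\<lambda>n. real (n choose r) / real n ^ r * ((1 - real r / real n) / real (Suc r)))
      \<longlonglongrightarrow> 1 / fact r * ((1 - 0) / real (Suc r))"
    by (intro tendsto_intros Suc lim_const_over_n) auto
  moreover have "\<forall>\<^sub>F n in sequentially. real (n choose r) / real n ^ r * ((1 - real r / real n) / real (Suc r))
      = real (n choose Suc r) / real n ^ Suc r"
    using eventually_gt_at_top[of r]
  proof eventually_elim
    case (elim n)
    have "Suc r * (n choose Suc r) = (n - r) * (n choose r)"
      by (metis binomial_absorb_comp binomial_absorption mult.commute)
    hence "real (Suc r) * real (n choose Suc r) = (real n - real r) * real (n choose r)"
      using elim by (metis of_nat_mult of_nat_diff less_imp_le)
    hence "real (n choose Suc r) = (real n - real r) * real (n choose r) / real (Suc r)"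
      by (simp add: field_simps)
    moreover have "1 - real r / real n = (real n - real r) / real n"
      using elim by (simp add: diff_divide_distrib)
    ultimately show ?case
      by (simp add: mult_ac)
  qed
  ultimately have "(\<lambda>n. real (n choose Suc r) / real n ^ Suc r) \<longlonglongrightarrow> 1 / fact r * ((1 - 0) / real (Suc r))"
    using Lim_transform_eventually by fastforce
  thus ?case
    by (simp add: field_simps)
qed

section \<open>The Gaussian tail at the Gumbel threshold\<close>

text \<open>
  The argument \<open>L\<close> stands for the logarithm of the number of vertices.
\<close>

definition gumbel_threshold :: "real \<Rightarrow> real \<Rightarrow> real" where
  "gumbel_threshold y L = sqrt (2 * L) * (1 - (ln L + ln (4 * pi)) / (4 * L) + y / (2 * L))"

lemma gumbel_threshold_asymp:
  "((\<lambda>L. gumbel_threshold y L / sqrt (2 * L)) \<longlongrightarrow> 1) at_top"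
  unfolding gumbel_threshold_def by real_asymp

text \<open>
  Write the threshold as \<open>sqrt (2 L) (1 - q)\<close>. Half its square is \<open>L - 2 L q + L q\<^sup>2\<close>, where \<open>2 L q\<close> is
  \<open>ln (4 pi L) / 2 - y\<close> and \<open>L q\<^sup>2\<close> vanishes. So \<open>exp L\<close> times the Gaussian density factor is about
  \<open>sqrt (4 pi L) exp (- y)\<close>, and the denominator \<open>sqrt (2 L)\<close> of the tail removes the growth.
\<close>

lemma gaussian_tail_at_gumbel_threshold:
  "((\<lambda>L. exp L / (gumbel_threshold y L * exp ((gumbel_threshold y L)\<^sup>2 / 2)))
      \<longlongrightarrow> sqrt (2 * pi) * exp (- y)) at_top"
proof -
  define c where "c = ln (4 * pi)"
  define q where "q = (\<lambda>L::real. (ln L + c) / (4 * L) - y / (2 * L))"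
  have q1: "(q \<longlongrightarrow> 0) at_top"
    unfolding q_def by real_asymp
  have q2: "((\<lambda>L. L * (q L)\<^sup>2) \<longlongrightarrow> 0) at_top"
    unfolding q_def by real_asymp
  have "((\<lambda>L. exp (c / 2 - y - L * (q L)\<^sup>2) / (sqrt 2 * (1 - q L))) \<longlongrightarrow> exp (c / 2 - y - 0) / (sqrt 2 * (1 - 0))) at_top"
    by (intro tendsto_intros q1 q2) auto
  moreover have "exp (c / 2 - y - 0) / (sqrt 2 * (1 - 0)) = sqrt (2 * pi) * exp (- y)"
  proof -
    have "exp (c / 2) = sqrt (4 * pi)"
      by (simp add: c_def powr_def flip: powr_half_sqrt)
    also have "\<dots> = sqrt 2 * sqrt (2 * pi)"
      by (simp flip: real_sqrt_mult)
    finally have "exp (c / 2) = sqrt 2 * sqrt (2 * pi)" .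
    moreover have "exp (c / 2 - y - 0) = exp (c / 2) * exp (- y)"
      by (simp flip: exp_add)
    ultimately show ?thesis
      by simp
  qed
  moreover have "\<forall>\<^sub>F L in at_top. exp (c / 2 - y - L * (q L)\<^sup>2) / (sqrt 2 * (1 - q L)) =
      exp L / (gumbel_threshold y L * exp ((gumbel_threshold y L)\<^sup>2 / 2))"
    using eventually_gt_at_top[of 0]
  proof eventually_elim
    case (elim L)
    have u: "gumbel_threshold y L = sqrt (2 * L) * (1 - q L)"
      by (simp add: gumbel_threshold_def q_def c_def)
    have "(gumbel_threshold y L)\<^sup>2 / 2 = L * (1 - q L)\<^sup>2"
      unfolding u using elim by (simp add: power_mult_distrib)
    also have "\<dots> = L - 2 * L * q L + L * (q L)\<^sup>2"
      by (simp add: power2_eq_square algebra_simps)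
    also have "2 * L * q L = ln L / 2 + (c / 2 - y)"
      using elim by (simp add: q_def field_simps)
    finally have "L - (gumbel_threshold y L)\<^sup>2 / 2 = ln L / 2 + (c / 2 - y - L * (q L)\<^sup>2)"
      by linarith
    hence "exp L / exp ((gumbel_threshold y L)\<^sup>2 / 2) = exp (ln L / 2) * exp (c / 2 - y - L * (q L)\<^sup>2)"
      by (metis exp_add exp_diff)
    also have "exp (ln L / 2) = sqrt L"
      using elim by (simp add: powr_def flip: powr_half_sqrt)
    finally have "exp L / (gumbel_threshold y L * exp ((gumbel_threshold y L)\<^sup>2 / 2))
        = sqrt L * exp (c / 2 - y - L * (q L)\<^sup>2) / gumbel_threshold y L"
      by (simp add: field_simps)
    also have "\<dots> = exp (c / 2 - y - L * (q L)\<^sup>2) / (sqrt 2 * (1 - q L))"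
      unfolding u using elim by (simp add: real_sqrt_mult)
    finally show ?case by simp
  qed
  ultimately show ?thesis
    using Lim_transform_eventually by fastforce
qed

text \<open>
  A perturbation \<open>d\<close> of the threshold \<open>u\<close> changes the exponent by \<open>u d + d\<^sup>2 / 2\<close>, and \<open>u \<sim> sqrt (2 L)\<close>, so that
  \<open>d = o (1 / sqrt L)\<close> is harmless. This absorbs the shifts of the degree threshold by a constant.
\<close>

lemma gaussian_tail_near_gumbel_threshold:
  fixes L x :: "nat \<Rightarrow> real"
  assumes L: "filterlim L at_top sequentially"
    and x: "(\<lambda>m. (x m - gumbel_threshold y (L m)) * sqrt (L m)) \<longlonglongrightarrow> 0"
  shows "(\<lambda>m. exp (L m) / (x m * exp ((x m)\<^sup>2 / 2))) \<longlonglongrightarrow> sqrt (2 * pi) * exp (- y)"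
    and "(\<lambda>m. x m / sqrt (2 * L m)) \<longlonglongrightarrow> 1"
proof -
  define u where "u = (\<lambda>m. gumbel_threshold y (L m))"
  define d where "d = (\<lambda>m. x m - u m)"
  have u: "(\<lambda>m. u m / sqrt (2 * L m)) \<longlonglongrightarrow> 1"
    unfolding u_def by (rule filterlim_compose[OF gumbel_threshold_asymp L])
  have L_pos: "\<forall>\<^sub>F m in sequentially. 0 < L m"
    using L by (simp add: filterlim_at_top_dense)
  have ds: "(\<lambda>m. d m * sqrt (L m)) \<longlonglongrightarrow> 0"
    using x by (simp add: d_def u_def)
  have sL: "filterlim (\<lambda>m. sqrt (L m)) at_top sequentially"
    by (rule filterlim_compose[OF sqrt_at_top L])
  have inv: "(\<lambda>m. 1 / sqrt (L m)) \<longlonglongrightarrow> 0"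
    by (rule tendsto_divide_0[OF tendsto_const filterlim_at_top_imp_at_infinity[OF sL]])
  have d0: "d \<longlonglongrightarrow> 0"
  proof -
    have "(\<lambda>m. d m * sqrt (L m) * (1 / sqrt (L m))) \<longlonglongrightarrow> 0 * 0"
      by (intro tendsto_intros ds inv)
    moreover have "\<forall>\<^sub>F m in sequentially. d m * sqrt (L m) * (1 / sqrt (L m)) = d m"
      using L_pos by eventually_elim simp
    ultimately show ?thesis
      using Lim_transform_eventually by fastforce
  qed
  have xs: "(\<lambda>m. u m / sqrt (2 * L m) + d m * (1 / sqrt (L m)) / sqrt 2) \<longlonglongrightarrow> 1 + 0 * 0 / sqrt 2"
    by (intro tendsto_intros u d0 inv) simp
  moreover have "u m / sqrt (2 * L m) + d m * (1 / sqrt (L m)) / sqrt 2 = x m / sqrt (2 * L m)" for m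
    by (simp add: d_def real_sqrt_mult diff_divide_distrib mult.commute)
  ultimately show x1: "(\<lambda>m. x m / sqrt (2 * L m)) \<longlonglongrightarrow> 1"
    by simp
  have ud: "(\<lambda>m. u m * d m) \<longlonglongrightarrow> 0"
  proof -
    have "(\<lambda>m. u m / sqrt (2 * L m) * sqrt 2 * (d m * sqrt (L m))) \<longlonglongrightarrow> 1 * sqrt 2 * 0"
      by (intro tendsto_intros u ds)
    moreover have "\<forall>\<^sub>F m in sequentially. u m / sqrt (2 * L m) * sqrt 2 * (d m * sqrt (L m)) = u m * d m"
      using L_pos by eventually_elim (simp add: real_sqrt_mult)
    ultimately show ?thesis
      using Lim_transform_eventually by fastforce
  qed
  have "(\<lambda>m. exp (L m) / (u m * exp ((u m)\<^sup>2 / 2)) * ((u m / sqrt (2 * L m)) / (x m / sqrt (2 * L m))) *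
      exp (- (u m * d m) - (d m)\<^sup>2 / 2)) \<longlonglongrightarrow> sqrt (2 * pi) * exp (- y) * (1 / 1) * exp (- 0 - 0\<^sup>2 / 2)"
    unfolding u_def
    by (intro tendsto_intros filterlim_compose[OF gaussian_tail_at_gumbel_threshold L]
          u[unfolded u_def] x1 ud[unfolded u_def] d0) auto
  moreover have "\<forall>\<^sub>F m in sequentially. exp (L m) / (u m * exp ((u m)\<^sup>2 / 2)) *
      ((u m / sqrt (2 * L m)) / (x m / sqrt (2 * L m))) * exp (- (u m * d m) - (d m)\<^sup>2 / 2)
      = exp (L m) / (x m * exp ((x m)\<^sup>2 / 2))"
    using L_pos order_tendstoD(1)[OF u zero_less_one]
  proof eventually_elim
    case (elim m)
    have "- (u m * d m) - (d m)\<^sup>2 / 2 = (u m)\<^sup>2 / 2 - (x m)\<^sup>2 / 2"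
      by (simp add: d_def power2_eq_square field_simps)
    hence E: "exp (- (u m * d m) - (d m)\<^sup>2 / 2) = exp ((u m)\<^sup>2 / 2) / exp ((x m)\<^sup>2 / 2)"
      by (simp only: exp_diff)
    show ?case
      unfolding E using elim by (simp add: field_simps)
  qed
  ultimately show "(\<lambda>m. exp (L m) / (x m * exp ((x m)\<^sup>2 / 2))) \<longlonglongrightarrow> sqrt (2 * pi) * exp (- y)"
    using Lim_transform_eventually by fastforce
qed

section \<open>Partial sums of the coordinates of a Bernoulli product\<close>

lemma finite_set_Pi_pmf_bool:
  fixes q :: "'a \<Rightarrow> bool pmf"
  assumes "finite J"
  shows "finite (set_pmf (Pi_pmf J False q))"
  unfolding set_Pi_pmf[OF assms] by (intro finite_PiE_dflt assms) auto

lemma expectation_prod_coordinates: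
  fixes g :: "'a \<Rightarrow> bool \<Rightarrow> 'c :: {real_normed_field, banach, second_countable_topology}"
  assumes J: "finite J" and B: "B \<subseteq> J"
  shows "measure_pmf.expectation (Pi_pmf J False q) (\<lambda>G. \<Prod>e\<in>B. g e (G e))
           = (\<Prod>e\<in>B. measure_pmf.expectation (q e) (g e))"
proof -
  let ?D = "Pi_pmf J False q"
  have fin: "finite B"
    using B J by (rule finite_subset)
  have "prob_space.indep_vars ?D (\<lambda>_. borel) (\<lambda>e G. g e (G e)) B"
    using prob_space.indep_vars_compose2[OF measure_pmf.prob_space_axioms prob_space.indep_vars_subset[OF measure_pmf.prob_space_axioms indep_vars_Pi_pmf[OF J] B],
        of "\<lambda>e. g e" "\<lambda>_. borel"] by simp
  hence "measure_pmf.expectation ?D (\<lambda>G. \<Prod>e\<in>B. g e (G e))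
      = (\<Prod>e\<in>B. measure_pmf.expectation ?D (\<lambda>G. g e (G e)))"
    by (intro prob_space.indep_vars_lebesgue_integral[OF measure_pmf.prob_space_axioms] fin integrable_measure_pmf_finite
        finite_set_Pi_pmf_bool J)
  also have "\<dots> = (\<Prod>e\<in>B. measure_pmf.expectation (q e) (g e))"
  proof (intro prod.cong refl)
    fix e assume "e \<in> B"
    hence "map_pmf (\<lambda>G. G e) ?D = q e"
      using Pi_pmf_component[OF J, of e False q] B by auto
    thus "measure_pmf.expectation ?D (\<lambda>G. g e (G e)) = measure_pmf.expectation (q e) (g e)"
      by (metis integral_map_pmf)
  qed
  finally show ?thesis .
qed

context
  fixes J B :: "'a set" and p :: "'a \<Rightarrow> real" and D :: "('a \<Rightarrow> bool) pmf"
  assumes J: "finite J" and B: "B \<subseteq> J" and p: "\<And>e. e \<in> B \<Longrightarrow> 0 \<le> p e \<and> p e \<le> 1"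
  defines "D \<equiv> Pi_pmf J False (\<lambda>e. bernoulli_pmf (p e))"
begin

lemma finite_index_subset: "finite B"
  using B J by (rule finite_subset)

lemma integrable_bernoulli_product: "integrable D f" for f :: "_ \<Rightarrow> 'c :: {banach, second_countable_topology}"
  unfolding D_def by (intro integrable_measure_pmf_finite finite_set_Pi_pmf_bool J)

text \<open>
  The left-hand side is the expectation of \<open>z\<close> to the number of successes, a product of functions of the separate
  coordinates.
\<close>

lemma pgf_bernoulli_sum:
  fixes z :: complex
  shows "(\<Sum>j\<le>card B. measure_pmf.prob D {G. card {e\<in>B. G e} = j} * z ^ j) = (\<Prod>e\<in>B. 1 - p e + p e * z)"
proof -
  have "(\<Sum>j\<le>card B. measure_pmf.prob D {G. card {e\<in>B. G e} = j} * z ^ j)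
      = (\<Sum>j\<le>card B. measure_pmf.expectation D (\<lambda>G. indicator {G. card {e\<in>B. G e} = j} G *\<^sub>R z ^ j))"
    by (intro sum.cong refl) (subst integral_scaleR_left, simp_all add: scaleR_conv_of_real integrable_bernoulli_product)
  also have "\<dots> = measure_pmf.expectation D (\<lambda>G. \<Sum>j\<le>card B. indicator {G. card {e\<in>B. G e} = j} G *\<^sub>R z ^ j)"
    by (rule Bochner_Integration.integral_sum[symmetric]) (rule integrable_bernoulli_product)
  also have "(\<lambda>G. \<Sum>j\<le>card B. indicator {G. card {e\<in>B. G e} = j} G *\<^sub>R z ^ j)
      = (\<lambda>G. \<Prod>e\<in>B. if G e then z else 1)"
  proof
    fix G
    have "card {e\<in>B. G e} \<le> card B"
      using finite_index_subset by (intro card_mono) auto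
    moreover have "(\<Sum>j\<le>card B. indicator {G. card {e\<in>B. G e} = j} G *\<^sub>R z ^ j)
        = (\<Sum>j\<le>card B. if j = card {e\<in>B. G e} then z ^ j else 0)"
      by (intro sum.cong) auto
    ultimately have "(\<Sum>j\<le>card B. indicator {G. card {e\<in>B. G e} = j} G *\<^sub>R z ^ j) = z ^ card {e\<in>B. G e}"
      by simp
    also have "\<dots> = (\<Prod>e\<in>B. if G e then z else 1)"
      using finite_index_subset by (simp add: prod.If_cases Int_def)
    finally show "(\<Sum>j\<le>card B. indicator {G. card {e\<in>B. G e} = j} G *\<^sub>R z ^ j) = (\<Prod>e\<in>B. if G e then z else 1)" .
  qed
  also have "measure_pmf.expectation D (\<lambda>G. \<Prod>e\<in>B. if G e then z else 1)
      = (\<Prod>e\<in>B. measure_pmf.expectation (bernoulli_pmf (p e)) (\<lambda>b. if b then z else 1))"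
    unfolding D_def by (rule expectation_prod_coordinates[OF J B])
  also have "\<dots> = (\<Prod>e\<in>B. 1 - p e + p e * z)"
  proof (intro prod.cong refl)
    fix e assume "e \<in> B"
    thus "measure_pmf.expectation (bernoulli_pmf (p e)) (\<lambda>b. if b then z else 1) = 1 - p e + p e * z"
      using p[of e] by (subst integral_measure_pmf[of UNIV]) (auto simp: UNIV_bool scaleR_conv_of_real)
  qed
  finally show ?thesis .
qed

lemma prob_bernoulli_sum_greater:
  fixes t :: real
  shows "measure_pmf.prob D {G. t < real (card {e\<in>B. G e})}
     = (\<Sum>j | j \<le> card B \<and> t < real j. measure_pmf.prob D {G. card {e\<in>B. G e} = j})"
proof -
  have "card {e\<in>B. G e} \<le> card B" for G
    using finite_index_subset by (intro card_mono) auto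
  hence "{G. t < real (card {e\<in>B. G e})} = (\<Union>j\<in>{j. j \<le> card B \<and> t < real j}. {G. card {e\<in>B. G e} = j})"
    by auto
  also have "measure_pmf.prob D \<dots> = (\<Sum>j | j \<le> card B \<and> t < real j. measure_pmf.prob D {G. card {e\<in>B. G e} = j})"
    by (intro measure_pmf.finite_measure_finite_Union) (auto simp: disjoint_family_on_def)
  finally show ?thesis .
qed

lemma expectation_coordinate:
  assumes "e \<in> B"
  shows "measure_pmf.expectation D (\<lambda>G. of_bool (G e)) = p e"
  using expectation_prod_coordinates[OF J, of "{e}" "\<lambda>e. bernoulli_pmf (p e)" "\<lambda>_ b. of_bool b :: real"]
    assms B p[of e] by (auto simp: D_def)

lemma covariance_coordinates:
  assumes "e \<in> B" "e' \<in> B"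
  shows "measure_pmf.expectation D (\<lambda>G. (of_bool (G e) - p e) * (of_bool (G e') - p e'))
           = (if e = e' then p e * (1 - p e) else 0)"
proof (cases "e = e'")
  case True
  have "measure_pmf.expectation D (\<lambda>G. (of_bool (G e) - p e) * (of_bool (G e) - p e))
      = measure_pmf.expectation (bernoulli_pmf (p e)) (\<lambda>b. (of_bool b - p e) * (of_bool b - p e))"
    using expectation_prod_coordinates[OF J, of "{e}" "\<lambda>e. bernoulli_pmf (p e)"
        "\<lambda>e b. (of_bool b - p e) * (of_bool b - p e)"] assms B by (auto simp: D_def)
  also have "\<dots> = p e * (1 - p e)"
    using p[OF assms(1)] by (simp add: algebra_simps)
  finally show ?thesis
    using True by simp
next
  case False
  have "measure_pmf.expectation D (\<lambda>G. (of_bool (G e) - p e) * (of_bool (G e') - p e'))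
      = measure_pmf.expectation (bernoulli_pmf (p e)) (\<lambda>b. of_bool b - p e) *
        measure_pmf.expectation (bernoulli_pmf (p e')) (\<lambda>b. of_bool b - p e')"
    using expectation_prod_coordinates[OF J, of "{e, e'}" "\<lambda>e. bernoulli_pmf (p e)" "\<lambda>e b. of_bool b - p e"]
      assms B False by (auto simp: D_def)
  also have "measure_pmf.expectation (bernoulli_pmf (p e)) (\<lambda>b. of_bool b - p e) = 0"
    using p[OF assms(1)] by (simp add: algebra_simps)
  finally show ?thesis
    using False by simp
qed

lemma expectation_bernoulli_sum:
  "measure_pmf.expectation D (\<lambda>G. real (card {e\<in>B. G e})) = (\<Sum>e\<in>B. p e)"
proof -
  have "real (card {e\<in>B. G e}) = (\<Sum>e\<in>B. of_bool (G e))" for G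
    using finite_index_subset by (simp add: of_bool_def sum.If_cases Int_def)
  thus ?thesis
    by (simp add: Bochner_Integration.integral_sum integrable_bernoulli_product expectation_coordinate)
qed

lemma variance_bernoulli_sum:
  "measure_pmf.variance D (\<lambda>G. real (card {e\<in>B. G e})) = (\<Sum>e\<in>B. p e * (1 - p e))"
proof -
  have "real (card {e\<in>B. G e}) = (\<Sum>e\<in>B. of_bool (G e))" for G
    using finite_index_subset by (simp add: of_bool_def sum.If_cases Int_def)
  hence "(real (card {e\<in>B. G e}) - (\<Sum>e\<in>B. p e))\<^sup>2
      = (\<Sum>e\<in>B. \<Sum>e'\<in>B. (of_bool (G e) - p e) * (of_bool (G e') - p e'))" for G
    by (simp add: power2_eq_square sum_product flip: sum_subtractf)
  hence "measure_pmf.variance D (\<lambda>G. real (card {e\<in>B. G e}))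
      = (\<Sum>e\<in>B. \<Sum>e'\<in>B. measure_pmf.expectation D (\<lambda>G. (of_bool (G e) - p e) * (of_bool (G e') - p e')))"
    unfolding expectation_bernoulli_sum
    by (simp add: Bochner_Integration.integral_sum integrable_bernoulli_product)
  also have "\<dots> = (\<Sum>e\<in>B. \<Sum>e'\<in>B. if e = e' then p e * (1 - p e) else 0)"
    by (intro sum.cong refl covariance_coordinates)
  also have "\<dots> = (\<Sum>e\<in>B. p e * (1 - p e))"
    using finite_index_subset by simp
  finally show ?thesis .
qed

end

text \<open>
  Independence of the coordinates passes to functions of disjoint groups of coordinates.
\<close>

lemma prob_disjoint_coordinates:
  assumes J: "finite J" and A: "finite A" and sub: "\<And>i. i \<in> A \<Longrightarrow> B i \<subseteq> J"
    and disj: "disjoint_family_on B A"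
  shows "measure_pmf.prob (Pi_pmf J False q) {G. \<forall>i\<in>A. t < real (card {e\<in>B i. G e})}
           = (\<Prod>i\<in>A. measure_pmf.prob (Pi_pmf J False q) {G. t < real (card {e\<in>B i. G e})})"
proof (cases "A = {}")
  case False
  let ?D = "Pi_pmf J False q"
  let ?M = "\<lambda>_ :: 'a. count_space (UNIV :: bool set)"
  let ?X = "\<lambda>i (G :: 'a \<Rightarrow> bool). real (card {e\<in>B i. G e})"
  have fin: "finite (B i)" if "i \<in> A" for i
    using sub[OF that] J by (rule finite_subset)
  have card_eq: "real (card {e\<in>B i. G e}) = (\<Sum>e\<in>B i. of_bool (G e))" if "i \<in> A" for i G
    using fin[OF that] by (simp add: of_bool_def sum.If_cases Int_def)
  have "prob_space.indep_vars ?D (\<lambda>i. PiM (B i) ?M) (\<lambda>i G. restrict (\<lambda>e. G e) (B i)) A"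
    by (rule prob_space.indep_vars_restrict[OF measure_pmf.prob_space_axioms indep_vars_Pi_pmf[OF J] sub disj])
  moreover have "(\<lambda>G. \<Sum>e\<in>B i. of_bool (G e) :: real) \<in> borel_measurable (PiM (B i) ?M)" for i
  proof (intro borel_measurable_sum)
    fix e assume "e \<in> B i"
    hence "(\<lambda>G. G e) \<in> measurable (PiM (B i) ?M) (count_space UNIV)"
      by (rule measurable_component_singleton)
    thus "(\<lambda>G. of_bool (G e) :: real) \<in> borel_measurable (PiM (B i) ?M)"
      by (rule measurable_compose) simp
  qed
  ultimately have "prob_space.indep_vars ?D (\<lambda>_. borel)
      (\<lambda>i G. \<Sum>e\<in>B i. of_bool (restrict (\<lambda>e. G e) (B i) e) :: real) A"
    by (rule prob_space.indep_vars_compose2[OF measure_pmf.prob_space_axioms])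
  from prob_space.indep_varsD_finite[OF measure_pmf.prob_space_axioms this False A, of "\<lambda>_. {t<..}"]
  have "measure_pmf.prob ?D (\<Inter>i\<in>A. (\<lambda>G. \<Sum>e\<in>B i. of_bool (G e)) -` {t<..})
      = (\<Prod>i\<in>A. measure_pmf.prob ?D ((\<lambda>G. \<Sum>e\<in>B i. of_bool (G e)) -` {t<..}))"
    by simp
  moreover have "(\<Inter>i\<in>A. (\<lambda>G. \<Sum>e\<in>B i. of_bool (G e) :: real) -` {t<..}) = {G. \<forall>i\<in>A. t < ?X i G}"
    using card_eq by auto
  moreover have "(\<Prod>i\<in>A. measure_pmf.prob ?D ((\<lambda>G. \<Sum>e\<in>B i. of_bool (G e)) -` {t<..}))
      = (\<Prod>i\<in>A. measure_pmf.prob ?D {G. t < ?X i G})"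
    using card_eq by (intro prod.cong refl arg_cong[where f = "measure_pmf.prob ?D"]) auto
  ultimately show ?thesis by simp
qed simp

section \<open>Degrees in the balanced stochastic block model\<close>

definition star :: "nat \<Rightarrow> nat set \<Rightarrow> nat set set" where
  "star i X = (\<lambda>j. {i, j}) ` X"

definition edge_prob :: "nat \<Rightarrow> nat set set \<Rightarrow> real \<Rightarrow> real \<Rightarrow> nat set \<Rightarrow> real" where
  "edge_prob n C a b e = (if \<exists>S\<in>C. e \<subseteq> S then a / real n else b / real n)"

lemma sbm_pmf_altdef:
  "sbm_pmf n C a b = Pi_pmf (possible_edges n) False (\<lambda>e. bernoulli_pmf (edge_prob n C a b e))"
  by (simp add: sbm_pmf_def edge_prob_def)

lemma finite_possible_edges: "finite (possible_edges n)"
  unfolding possible_edges_def by (rule finite_subset[of _ "Pow {1..n}"]) auto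

lemma inj_on_star: "inj_on (\<lambda>j. {i, j}) X"
  by (auto simp: inj_on_def doubleton_eq_iff)

lemma star_subset_possible_edges:
  assumes "i \<in> {1..n}" "X \<subseteq> {1..n} - {i}"
  shows "star i X \<subseteq> possible_edges n"
  using assms by (auto simp: star_def possible_edges_def card_insert_if)

lemma vertex_degree_eq_card: "vertex_degree n G i = real (card {e\<in>star i ({1..n} - {i}). G e})"
proof -
  have "vertex_degree n G i = (\<Sum>e\<in>star i ({1..n} - {i}). of_bool (G e))"
    unfolding vertex_degree_def adj_def star_def by (simp add: sum.reindex[OF inj_on_star])
  also have "\<dots> = real (card {e\<in>star i ({1..n} - {i}). G e})"
    by (simp add: star_def of_bool_def sum.If_cases Int_def)
  finally show ?thesis .
qed

lemma
  fixes i n k :: nat and a b :: real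
  assumes C: "C \<in> balanced_partitions k n" and k: "1 \<le> k" and i: "i \<in> {1..n}"
  defines "s \<equiv> n div k"
  shows prod_star_edge_prob: "(\<Prod>e\<in>star i ({1..n} - {i}). f (edge_prob n C a b e))
      = (f (a / real n) ^ (s - 1) * f (b / real n) ^ (n - s) :: 'c :: comm_monoid_mult)"
    and sum_star_edge_prob: "(\<Sum>e\<in>star i ({1..n} - {i}). g (edge_prob n C a b e))
      = real (s - 1) * g (a / real n) + real (n - s) * (g (b / real n) :: real)"
proof -
  let ?X = "{1..n} - {i}"
  have part: "partition_on {1..n} C"
    using C by (simp add: balanced_partitions_def)
  obtain S where S: "S \<in> C" "i \<in> S"
    using i partition_onD1[OF part] by blast
  have S_sub: "S \<subseteq> {1..n}"
    using S(1) partition_onD1[OF part] by auto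
  have "real (card S) * real k = real n"
    using C S(1) k by (simp add: balanced_partitions_def)
  hence "card S * k = n"
    by (metis of_nat_eq_iff of_nat_mult)
  hence card_S: "card S = s"
    using k by (auto simp: s_def)
  have same: "(\<exists>T\<in>C. {i, j} \<subseteq> T) \<longleftrightarrow> j \<in> S" for j
    using S partition_onD2[OF part] by (auto simp: disjoint_def)
  have fin: "finite S"
    using S_sub by (rule finite_subset) simp
  have in_S: "card (?X \<inter> S) = s - 1"
  proof -
    have "?X \<inter> S = S - {i}"
      using S_sub by auto
    thus ?thesis
      using S(2) fin card_S by simp
  qed
  have out_S: "card (?X \<inter> - S) = n - s"
  proof -
    have "?X \<inter> - S = {1..n} - S"
      using S(2) by auto
    thus ?thesis
      using card_Diff_subset[OF fin S_sub] card_S by simp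
  qed
  show "(\<Prod>e\<in>star i ?X. f (edge_prob n C a b e)) = f (a / real n) ^ (s - 1) * f (b / real n) ^ (n - s)"
  proof -
    have "(\<Prod>e\<in>star i ?X. f (edge_prob n C a b e)) = (\<Prod>j\<in>?X. if j \<in> S then f (a / real n) else f (b / real n))"
      unfolding star_def prod.reindex[OF inj_on_star] o_def edge_prob_def same by (intro prod.cong) auto
    thus ?thesis
      using in_S out_S by (simp add: prod.If_cases)
  qed
  show "(\<Sum>e\<in>star i ?X. g (edge_prob n C a b e)) = real (s - 1) * g (a / real n) + real (n - s) * g (b / real n)"
  proof -
    have "(\<Sum>e\<in>star i ?X. g (edge_prob n C a b e)) = (\<Sum>j\<in>?X. if j \<in> S then g (a / real n) else g (b / real n))"
      unfolding star_def sum.reindex[OF inj_on_star] o_def edge_prob_def same by (intro sum.cong) auto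
    thus ?thesis
      using in_S out_S by (simp add: sum.If_cases)
  qed
qed

context
  fixes n k :: nat and C :: "nat set set" and a b :: real and D :: "(nat set \<Rightarrow> bool) pmf"
  assumes k: "1 \<le> k" and n: "1 \<le> n" and C: "C \<in> balanced_partitions k n"
    and b_pos: "0 < b" and b_less_a: "b < a" and a_le: "a \<le> real n / 2"
  defines "D \<equiv> sbm_pmf n C a b"
begin

lemma edge_prob_bounds: "b / real n \<le> edge_prob n C a b e" "0 < edge_prob n C a b e" "edge_prob n C a b e \<le> 1 / 2"
proof -
  have "a / real n \<le> 1 / 2" "b / real n \<le> a / real n" "0 < b / real n"
    using n b_pos b_less_a a_le by (auto simp: field_simps)
  moreover from this have "b / real n \<le> 1 / 2"
    by linarith
  ultimately show "b / real n \<le> edge_prob n C a b e" "0 < edge_prob n C a b e" "edge_prob n C a b e \<le> 1 / 2"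
    by (auto simp: edge_prob_def)
qed

lemma edge_prob_in_unit_interval: "0 \<le> edge_prob n C a b e \<and> edge_prob n C a b e \<le> 1"
  using edge_prob_bounds[of e] by auto

lemma degree_pgf:
  fixes z :: complex
  assumes "i \<in> {1..n}"
  shows "(\<Sum>j\<le>n - 1. complex_of_real (measure_pmf.prob D {G. card {e\<in>star i ({1..n} - {i}). G e} = j}) * z ^ j)
       = (\<Prod>e\<in>star i ({1..n} - {i}). 1 - edge_prob n C a b e + edge_prob n C a b e * z)"
proof -
  have "card (star i ({1..n} - {i})) = n - 1"
    using assms by (simp add: star_def card_image[OF inj_on_star])
  thus ?thesis
    using pgf_bernoulli_sum[OF finite_possible_edges star_subset_possible_edges[OF assms order_refl]
        edge_prob_in_unit_interval, where z = z]
    by (simp add: D_def sbm_pmf_altdef)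
qed

lemma prob_degree_greater:
  assumes "i \<in> {1..n}"
  shows "measure_pmf.prob D {G. t < vertex_degree n G i}
     = (\<Sum>j | j \<le> n - 1 \<and> t < real j. measure_pmf.prob D {G. card {e\<in>star i ({1..n} - {i}). G e} = j})"
proof -
  have "card (star i ({1..n} - {i})) = n - 1"
    using assms by (simp add: star_def card_image[OF inj_on_star])
  thus ?thesis
    using prob_bernoulli_sum_greater[OF finite_possible_edges star_subset_possible_edges[OF assms order_refl]
        edge_prob_in_unit_interval, where t = t]
    by (simp add: D_def sbm_pmf_altdef vertex_degree_eq_card)
qed

text \<open>
  In a balanced partition every vertex has \<open>n / k - 1\<close> possible neighbours in its own block and \<open>n - n / k\<close> outside, so
  all degrees have the same generating function, and the generating function determines the law.
\<close>

lemma prob_degree_greater_eq: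
  assumes i: "i \<in> {1..n}"
  shows "measure_pmf.prob D {G. t < vertex_degree n G i} = measure_pmf.prob D {G. t < vertex_degree n G 1}"
proof -
  have 1: "1 \<in> {1..n}"
    using n by simp
  let ?w = "\<lambda>i j. complex_of_real (measure_pmf.prob D {G. card {e\<in>star i ({1..n} - {i}). G e} = j})"
  have "(\<Sum>j\<le>n - 1. ?w i j * z ^ j) = (\<Sum>j\<le>n - 1. ?w 1 j * z ^ j)" for z
    unfolding degree_pgf[OF i] degree_pgf[OF 1]
      prod_star_edge_prob[OF C k i, where f = "\<lambda>p. complex_of_real (1 - p) + of_real p * z"]
      prod_star_edge_prob[OF C k 1, where f = "\<lambda>p. complex_of_real (1 - p) + of_real p * z"] ..
  hence "\<forall>j\<le>n - 1. ?w i j = ?w 1 j"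
    by (intro polyfun_eq_coeffs[THEN iffD1] allI)
  thus ?thesis
    unfolding prob_degree_greater[OF i] prob_degree_greater[OF 1] by (intro sum.cong) auto
qed

lemma expectation_degree:
  assumes "i \<in> {1..n}"
  shows "measure_pmf.expectation D (\<lambda>G. vertex_degree n G i) = (\<Sum>e\<in>star i ({1..n} - {i}). edge_prob n C a b e)"
  unfolding vertex_degree_eq_card D_def sbm_pmf_altdef
  by (rule expectation_bernoulli_sum[OF finite_possible_edges star_subset_possible_edges[OF assms order_refl]
      edge_prob_in_unit_interval])

lemma variance_degree:
  assumes "i \<in> {1..n}"
  shows "measure_pmf.variance D (\<lambda>G. vertex_degree n G i)
    = (\<Sum>e\<in>star i ({1..n} - {i}). edge_prob n C a b e * (1 - edge_prob n C a b e))"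
  unfolding vertex_degree_eq_card D_def sbm_pmf_altdef
  by (rule variance_bernoulli_sum[OF finite_possible_edges star_subset_possible_edges[OF assms order_refl]
      edge_prob_in_unit_interval])

text \<open>
  Each of the \<open>n - 1\<close> incident edges contributes at least \<open>(b / n) / 2\<close>.
\<close>

lemma variance_degree_ge:
  assumes i: "i \<in> {1..n}" and n2: "2 \<le> n"
  shows "b / 4 \<le> measure_pmf.variance D (\<lambda>G. vertex_degree n G i)"
proof -
  have "b / 4 \<le> real (n - 1) * (b / real n * (1 / 2))"
    using n2 b_pos by (simp add: field_simps of_nat_diff)
  also have "\<dots> = (\<Sum>e\<in>star i ({1..n} - {i}). b / real n * (1 / 2))"
    using i by (simp add: star_def card_image[OF inj_on_star])
  also have "\<dots> \<le> (\<Sum>e\<in>star i ({1..n} - {i}). edge_prob n C a b e * (1 - edge_prob n C a b e))"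
  proof (intro sum_mono mult_mono)
    fix e
    show "b / real n \<le> edge_prob n C a b e" "1 / 2 \<le> 1 - edge_prob n C a b e" "0 \<le> edge_prob n C a b e"
      using edge_prob_bounds[of e] by auto
  qed auto
  finally show ?thesis
    unfolding variance_degree[OF i] .
qed

text \<open>
  The numbers \<open>X i\<close> of neighbours of \<open>i\<close> outside \<open>A\<close> depend on disjoint sets of edges for different \<open>i \<in> A\<close>, hence are
  independent, and \<open>X i\<close> is at most the degree of \<open>i\<close>, which is at most \<open>X i + card A\<close>. Passing from degrees to the
  \<open>X i\<close>, using independence, and passing back costs a shift of the threshold by \<open>card A\<close> in either direction.
\<close>

lemma joint_exceedance_bounds:
  fixes t :: real
  assumes A: "A \<subseteq> {1..n}"
  defines "Q \<equiv> \<lambda>s. measure_pmf.prob D {G. s < vertex_degree n G 1}"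
  shows "Q (t + card A) ^ card A \<le> measure_pmf.prob D (\<Inter>i\<in>A. {G. t < vertex_degree n G i})"
    and "measure_pmf.prob D (\<Inter>i\<in>A. {G. t < vertex_degree n G i}) \<le> Q (t - card A) ^ card A"
proof -
  define X where "X = (\<lambda>i (G :: nat set \<Rightarrow> bool). real (card {e\<in>star i ({1..n} - A). G e}))"
  have fin: "finite A"
    using A by (rule finite_subset) simp
  have X_le: "X i G \<le> vertex_degree n G i" if "i \<in> A" for i G
    unfolding X_def vertex_degree_eq_card of_nat_le_iff using that
    by (intro card_mono) (auto simp: star_def)
  have le_X: "vertex_degree n G i \<le> X i G + card A" if "i \<in> A" for i G
  proof -
    have "card {e\<in>star i ({1..n} - {i}). G e} \<le> card ({e\<in>star i ({1..n} - A). G e} \<union> star i A)"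
      using fin by (intro card_mono) (auto simp: star_def)
    also have "\<dots> \<le> card {e\<in>star i ({1..n} - A). G e} + card (star i A)"
      by (rule card_Un_le)
    also have "card (star i A) \<le> card A"
      unfolding star_def by (rule card_image_le[OF fin])
    finally show ?thesis
      unfolding X_def vertex_degree_eq_card by simp
  qed
  have indep: "measure_pmf.prob D {G. \<forall>i\<in>A. s < X i G} = (\<Prod>i\<in>A. measure_pmf.prob D {G. s < X i G})" for s
    unfolding X_def D_def sbm_pmf_altdef
  proof (rule prob_disjoint_coordinates[OF finite_possible_edges fin])
    show "star i ({1..n} - A) \<subseteq> possible_edges n" if "i \<in> A" for i
      using that A by (intro star_subset_possible_edges) auto
    show "disjoint_family_on (\<lambda>i. star i ({1..n} - A)) A"
      by (auto simp: disjoint_family_on_def star_def doubleton_eq_iff)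
  qed
  have law: "measure_pmf.prob D {G. s < vertex_degree n G i} = Q s" if "i \<in> A" for i s
    unfolding Q_def using that A by (intro prob_degree_greater_eq) auto
  have sub1: "{G. s + card A < vertex_degree n G i} \<subseteq> {G. s < X i G}"
    and sub2: "{G. s < X i G} \<subseteq> {G. s < vertex_degree n G i}" if "i \<in> A" for i and s :: real
  proof -
    show "{G. s + card A < vertex_degree n G i} \<subseteq> {G. s < X i G}"
    proof clarify
      fix G assume "s + card A < vertex_degree n G i"
      with le_X[OF that, of G] show "s < X i G" by linarith
    qed
    show "{G. s < X i G} \<subseteq> {G. s < vertex_degree n G i}"
    proof clarify
      fix G assume "s < X i G"
      with X_le[OF that, of G] show "s < vertex_degree n G i" by linarith
    qed
  qed
  have "Q (t + card A) ^ card A = (\<Prod>i\<in>A. measure_pmf.prob D {G. t + card A < vertex_degree n G i})"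
    using law by simp
  also have "\<dots> \<le> (\<Prod>i\<in>A. measure_pmf.prob D {G. t < X i G})"
    by (intro prod_mono conjI measure_nonneg measure_pmf.finite_measure_mono sub1) auto
  also have "\<dots> \<le> measure_pmf.prob D (\<Inter>i\<in>A. {G. t < vertex_degree n G i})"
    unfolding indep[symmetric] using sub2 by (intro measure_pmf.finite_measure_mono) auto
  finally show "Q (t + card A) ^ card A \<le> measure_pmf.prob D (\<Inter>i\<in>A. {G. t < vertex_degree n G i})" .
  have "measure_pmf.prob D (\<Inter>i\<in>A. {G. t < vertex_degree n G i}) \<le> measure_pmf.prob D {G. \<forall>i\<in>A. t - card A < X i G}"
    using sub1[of _ "t - card A"] by (intro measure_pmf.finite_measure_mono) auto
  also have "\<dots> \<le> (\<Prod>i\<in>A. measure_pmf.prob D {G. t - card A < vertex_degree n G i})"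
    unfolding indep by (intro prod_mono conjI measure_nonneg measure_pmf.finite_measure_mono sub2) auto
  also have "\<dots> = Q (t - card A) ^ card A"
    using law by simp
  finally show "measure_pmf.prob D (\<Inter>i\<in>A. {G. t < vertex_degree n G i}) \<le> Q (t - card A) ^ card A" .
qed

lemma factorial_moment_bounds:
  fixes t :: real and r :: nat
  defines "Q \<equiv> \<lambda>s. measure_pmf.prob D {G. s < vertex_degree n G 1}"
    and "F \<equiv> factorial_moment D {1..n} (\<lambda>i. {G. t < vertex_degree n G i}) r"
  shows "real (n choose r) * Q (t + r) ^ r \<le> F" and "F \<le> real (n choose r) * Q (t - r) ^ r"
proof -
  have card: "card {A. A \<subseteq> {1..n} \<and> card A = r} = n choose r"
    by (simp add: n_subsets)
  have "real (n choose r) * Q (t + r) ^ r = (\<Sum>A | A \<subseteq> {1..n} \<and> card A = r. Q (t + r) ^ r)"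
    by (simp only: card sum_constant)
  also have "\<dots> \<le> F"
    unfolding F_def factorial_moment_def Q_def using joint_exceedance_bounds(1)[of _ t] by (intro sum_mono) blast
  finally show "real (n choose r) * Q (t + r) ^ r \<le> F" .
  have "F \<le> (\<Sum>A | A \<subseteq> {1..n} \<and> card A = r. Q (t - r) ^ r)"
    unfolding F_def factorial_moment_def Q_def using joint_exceedance_bounds(2)[of _ t] by (intro sum_mono) blast
  also have "\<dots> = real (n choose r) * Q (t - r) ^ r"
    by (simp only: card sum_constant)
  finally show "F \<le> real (n choose r) * Q (t - r) ^ r" .
qed

end

section \<open>The limit law of the maximal degree\<close>

text \<open>
  Limits along the multiples of \<open>k\<close> become limits of ordinary sequences, for which dominated convergence is available.
\<close>

lemma multiples_at_top_conv_filtermap: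
  assumes "1 \<le> k"
  shows "multiples_at_top k = filtermap (\<lambda>m. k * m) sequentially"
proof (rule filter_eq_iff[THEN iffD2], intro allI)
  fix P
  show "eventually P (multiples_at_top k) \<longleftrightarrow> eventually P (filtermap (\<lambda>m. k * m) sequentially)"
    unfolding multiples_at_top_def eventually_inf_principal eventually_filtermap
  proof
    assume "\<forall>\<^sub>F n in sequentially. n \<in> {n. k dvd n} \<longrightarrow> P n"
    then obtain N where "\<forall>n\<ge>N. k dvd n \<longrightarrow> P n"
      by (auto simp: eventually_sequentially)
    moreover have "m \<le> k * m" for m
      using assms by simp
    ultimately have "\<forall>m\<ge>N. P (k * m)"
      by (meson dvd_triv_left order_trans)
    thus "\<forall>\<^sub>F m in sequentially. P (k * m)"
      by (auto simp: eventually_sequentially)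
  next
    assume "\<forall>\<^sub>F m in sequentially. P (k * m)"
    then obtain N where N: "\<forall>m\<ge>N. P (k * m)"
      by (auto simp: eventually_sequentially)
    have "P n" if "k * N \<le> n" "k dvd n" for n
      using that N assms by (auto elim!: dvdE)
    thus "\<forall>\<^sub>F n in sequentially. n \<in> {n. k dvd n} \<longrightarrow> P n"
      by (auto simp: eventually_sequentially)
  qed
qed

text \<open>
  The limit law along a sequence of graph sizes. The variance is at least \<open>b / 4\<close>, so \<open>b \<gg> (ln n)\<^sup>3\<close> gives
  \<open>\<rho> = (2 ln n) powr (3 / 2) / \<sigma> \<rightarrow> 0\<close>. This one quantity controls both the rate \<open>x\<^sup>3 / \<sigma>\<close> in the tail estimate and the
  effect \<open>d / \<sigma>\<close> of shifting the degree threshold by a constant \<open>d\<close>.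
\<close>

lemma max_degree_tendsto_gumbel:
  fixes n :: "nat \<Rightarrow> nat" and C :: "nat \<Rightarrow> nat set set" and a b :: "nat \<Rightarrow> real" and k :: nat and y :: real
  assumes k: "1 \<le> k" and n2: "\<And>m. 2 \<le> n m" and n: "filterlim n at_top sequentially"
    and C: "\<And>m. C m \<in> balanced_partitions k (n m)"
    and ab: "\<And>m. 0 < b m \<and> b m < a m \<and> a m \<le> real (n m) / 2"
    and b: "filterlim (\<lambda>m. b m / ln (real (n m)) ^ 3) at_top sequentially"
  defines "D \<equiv> \<lambda>m. sbm_pmf (n m) (C m) (a m) (b m)"
  defines "\<mu> \<equiv> \<lambda>m. measure_pmf.expectation (D m) (\<lambda>G. vertex_degree (n m) G 1)"
    and "\<sigma> \<equiv> \<lambda>m. sqrt (measure_pmf.variance (D m) (\<lambda>G. vertex_degree (n m) G 1))"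
  shows "(\<lambda>m. measure_pmf.prob (D m) {G. ((MAX i\<in>{1..n m}. vertex_degree (n m) G i) - \<mu> m) / \<sigma> m
            \<le> gumbel_threshold y (ln (real (n m)))}) \<longlonglongrightarrow> exp (- exp (- y))"
proof -
  define L where "L = (\<lambda>m. ln (real (n m)))"
  define u where "u = (\<lambda>m. gumbel_threshold y (L m))"
  define Q where "Q = (\<lambda>m s. measure_pmf.prob (D m) {G. s < vertex_degree (n m) G 1})"
  define J where "J = (\<lambda>m. star 1 ({1..n m} - {1}))"
  define p where "p = (\<lambda>m. edge_prob (n m) (C m) (a m) (b m))"
  have n1: "1 \<le> n m" and one: "1 \<in> {1..n m}" for m
    using n2[of m] by auto
  have a1: "0 < b m" and a2: "b m < a m" and a3: "a m \<le> real (n m) / 2" for m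
    using ab by auto
  note model = k n1 C a1 a2 a3
  have real_n: "filterlim (\<lambda>m. real (n m)) at_top sequentially"
    by (rule filterlim_compose[OF filterlim_real_sequentially n])
  have L: "filterlim L at_top sequentially"
    unfolding L_def by (rule filterlim_compose[OF ln_at_top real_n])
  have L_ge_1: "\<forall>\<^sub>F m in sequentially. 1 \<le> L m"
    using L by (simp add: filterlim_at_top)
  have var_ge: "b m / 4 \<le> (\<sigma> m)\<^sup>2" for m
  proof -
    have "b m / 4 \<le> measure_pmf.variance (D m) (\<lambda>G. vertex_degree (n m) G 1)"
      unfolding D_def by (rule variance_degree_ge[OF model one n2])
    thus ?thesis
      using a1[of m] by (simp add: \<sigma>_def)
  qed
  have \<sigma>_pos: "0 < \<sigma> m" for m
  proof -
    have "0 < (\<sigma> m)\<^sup>2"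
      using var_ge[of m] a1[of m] by linarith
    moreover have "0 \<le> \<sigma> m"
      by (simp add: \<sigma>_def)
    ultimately show ?thesis
      by (auto simp: order_less_le)
  qed
  have \<mu>_eq: "\<mu> m = (\<Sum>e\<in>J m. p m e)" for m
    unfolding \<mu>_def D_def J_def p_def by (rule expectation_degree[OF model one])
  have \<sigma>_eq: "\<sigma> m = sqrt (\<Sum>e\<in>J m. p m e * (1 - p m e))" for m
    unfolding \<sigma>_def D_def J_def p_def by (subst variance_degree[OF model one]) simp

  define \<rho> where "\<rho> = (\<lambda>m. sqrt (2 * L m) ^ 3 / \<sigma> m)"
  have \<rho>_lim: "\<rho> \<longlonglongrightarrow> 0"
  proof (rule tendsto_sandwich[OF _ _ tendsto_const])
    have "(\<lambda>m. inverse (b m / L m ^ 3)) \<longlonglongrightarrow> 0"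
      using b unfolding L_def by (rule tendsto_inverse_0_at_top)
    hence "(\<lambda>m. sqrt (32 * inverse (b m / L m ^ 3))) \<longlonglongrightarrow> sqrt (32 * 0)"
      by (intro tendsto_intros)
    thus "(\<lambda>m. sqrt (32 * inverse (b m / L m ^ 3))) \<longlonglongrightarrow> 0"
      by simp
    show "\<forall>\<^sub>F m in sequentially. 0 \<le> \<rho> m"
      using L_ge_1 by eventually_elim (use \<sigma>_pos in \<open>simp add: \<rho>_def less_imp_le\<close>)
    show "\<forall>\<^sub>F m in sequentially. \<rho> m \<le> sqrt (32 * inverse (b m / L m ^ 3))"
      using L_ge_1
    proof eventually_elim
      case (elim m)
      have "(\<rho> m)\<^sup>2 = (sqrt (2 * L m) ^ 2) ^ 3 / (\<sigma> m)\<^sup>2"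
        by (simp add: \<rho>_def power_divide flip: power_mult)
      also have "\<dots> = 8 * L m ^ 3 / (\<sigma> m)\<^sup>2"
        using elim by (simp add: power_mult_distrib)
      also have "\<dots> \<le> 8 * L m ^ 3 / (b m / 4)"
        using elim a1[of m] var_ge[of m] \<sigma>_pos[of m] by (intro divide_left_mono) auto
      also have "\<dots> = 32 * inverse (b m / L m ^ 3)"
        using elim by (simp add: field_simps)
      finally show ?case
        by (rule real_le_rsqrt)
    qed
  qed

  \<comment> \<open>The expected number of exceedances, for every standardised threshold \<open>x\<close> close enough to \<open>u\<close>.\<close>
  have tail: "(\<lambda>m. real (n m) * Q m (\<mu> m + \<sigma> m * x m)) \<longlonglongrightarrow> exp (- y)"
    if x: "(\<lambda>m. (x m - u m) * sqrt (L m)) \<longlonglongrightarrow> 0" for x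
  proof -
    note x' = gaussian_tail_near_gumbel_threshold[OF L x[unfolded u_def]]
    have s: "filterlim (\<lambda>m. sqrt (2 * L m)) at_top sequentially"
      by (intro filterlim_compose[OF sqrt_at_top] filterlim_tendsto_pos_mult_at_top[OF tendsto_const _ L]) simp
    have x_eq: "\<forall>\<^sub>F m in sequentially. x m / sqrt (2 * L m) * sqrt (2 * L m) = x m"
      using L_ge_1 by eventually_elim simp
    have x_top: "filterlim x at_top sequentially"
      using filterlim_tendsto_pos_mult_at_top[OF x'(2) zero_less_one s]
      by (rule filterlim_cong[THEN iffD1, OF refl refl, rotated]) (rule x_eq)
    have "(\<lambda>m. (x m / sqrt (2 * L m)) ^ 3 * \<rho> m) \<longlonglongrightarrow> 1 ^ 3 * 0"
      by (intro tendsto_intros x'(2) \<rho>_lim)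
    moreover have "\<forall>\<^sub>F m in sequentially. (x m / sqrt (2 * L m)) ^ 3 * \<rho> m = x m ^ 3 / \<sigma> m"
      using L_ge_1 by eventually_elim (simp add: \<rho>_def power_divide)
    ultimately have rate: "(\<lambda>m. x m ^ 3 / \<sigma> m) \<longlonglongrightarrow> 0"
      using Lim_transform_eventually by fastforce
    have "(\<lambda>m. x m * exp ((x m)\<^sup>2 / 2) * (\<Sum>j | j \<le> n m - 1 \<and> \<mu> m + \<sigma> m * x m < real j.
        measure_pmf.prob (D m) {G. card {e\<in>J m. G e} = j})) \<longlonglongrightarrow> 1 / sqrt (2 * pi)"
      unfolding \<mu>_eq \<sigma>_eq
    proof (rule poisson_binomial_moderate_deviation)
      show "finite (J m)" for m
        by (simp add: J_def star_def)
      show "0 \<le> p m e \<and> p m e \<le> 1 / 2" for m e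
        unfolding p_def
        by (rule conjI[OF less_imp_le[OF edge_prob_bounds(2)[OF model]] edge_prob_bounds(3)[OF model]])
      show "(\<Sum>j\<le>n m - 1. complex_of_real (measure_pmf.prob (D m) {G. card {e\<in>J m. G e} = j}) * z ^ j)
          = (\<Prod>e\<in>J m. complex_of_real (1 - p m e) + complex_of_real (p m e) * z)" for m z
        unfolding J_def p_def D_def by (rule degree_pgf[OF model one])
      show "0 < sqrt (\<Sum>e\<in>J m. p m e * (1 - p m e))" for m
        using \<sigma>_pos[of m] unfolding \<sigma>_eq .
      show "(\<lambda>m. x m ^ 3 / sqrt (\<Sum>e\<in>J m. p m e * (1 - p m e))) \<longlonglongrightarrow> 0"
        using rate unfolding \<sigma>_eq .
    qed (rule x_top)
    moreover have "Q m s = (\<Sum>j | j \<le> n m - 1 \<and> s < real j. measure_pmf.prob (D m) {G. card {e\<in>J m. G e} = j})"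
      for m s
      unfolding Q_def J_def D_def by (rule prob_degree_greater[OF model one])
    ultimately have "(\<lambda>m. x m * exp ((x m)\<^sup>2 / 2) * Q m (\<mu> m + \<sigma> m * x m)) \<longlonglongrightarrow> 1 / sqrt (2 * pi)"
      by simp
    from tendsto_mult[OF x'(1) this]
    have "(\<lambda>m. exp (L m) / (x m * exp ((x m)\<^sup>2 / 2)) * (x m * exp ((x m)\<^sup>2 / 2) * Q m (\<mu> m + \<sigma> m * x m)))
        \<longlonglongrightarrow> exp (- y)"
      by simp
    moreover have "\<forall>\<^sub>F m in sequentially. exp (L m) / (x m * exp ((x m)\<^sup>2 / 2)) *
        (x m * exp ((x m)\<^sup>2 / 2) * Q m (\<mu> m + \<sigma> m * x m)) = real (n m) * Q m (\<mu> m + \<sigma> m * x m)"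
      using filterlim_at_top_dense[THEN iffD1, OF x_top, rule_format, of 0]
    proof eventually_elim
      case (elim m)
      have "exp (L m) = real (n m)"
        using n1[of m] by (simp add: L_def)
      thus ?case
        using elim by simp
    qed
    ultimately show ?thesis
      using Lim_transform_eventually by fastforce
  qed

  have moments: "(\<lambda>m. factorial_moment (D m) {1..n m} (\<lambda>i. {G. \<mu> m + \<sigma> m * u m < vertex_degree (n m) G i}) r)
      \<longlonglongrightarrow> exp (- y) ^ r / fact r" for r
  proof -
    \<comment> \<open>A shift of the degree threshold by \<open>d\<close> is a shift of the standardised threshold by \<open>d / \<sigma>\<close>.\<close>
    have shifted: "(\<lambda>m. real (n m choose r) * Q m (\<mu> m + \<sigma> m * u m + d) ^ r) \<longlonglongrightarrow> exp (- y) ^ r / fact r"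
      for d :: real
    proof -
      have "(\<lambda>m. real (n m) * Q m (\<mu> m + \<sigma> m * (u m + d / \<sigma> m))) \<longlonglongrightarrow> exp (- y)"
      proof (rule tail, rule Lim_null_comparison)
        show "\<forall>\<^sub>F m in sequentially. norm ((u m + d / \<sigma> m - u m) * sqrt (L m)) \<le> \<bar>d\<bar> * \<rho> m"
          using L_ge_1
        proof eventually_elim
          case (elim m)
          have "sqrt (L m) \<le> sqrt (2 * L m) ^ 1"
            using elim by simp
          also have "\<dots> \<le> sqrt (2 * L m) ^ 3"
            using elim by (intro power_increasing) auto
          finally have "\<bar>d\<bar> / \<sigma> m * sqrt (L m) \<le> \<bar>d\<bar> / \<sigma> m * sqrt (2 * L m) ^ 3"
            using \<sigma>_pos[of m] by (intro mult_left_mono) auto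
          thus ?case
            using \<sigma>_pos[of m] elim by (simp add: \<rho>_def abs_mult)
        qed
        show "(\<lambda>m. \<bar>d\<bar> * \<rho> m) \<longlonglongrightarrow> 0"
          using tendsto_mult_right_zero[OF \<rho>_lim] .
      qed
      moreover have "\<mu> m + \<sigma> m * (u m + d / \<sigma> m) = \<mu> m + \<sigma> m * u m + d" for m
        using \<sigma>_pos[of m] by (simp add: field_simps)
      ultimately have "(\<lambda>m. real (n m) * Q m (\<mu> m + \<sigma> m * u m + d)) \<longlonglongrightarrow> exp (- y)"
        by simp
      moreover have "(\<lambda>m. real (n m choose r) / real (n m) ^ r) \<longlonglongrightarrow> 1 / fact r"
        by (rule filterlim_compose[OF binomial_over_power_tendsto n])
      ultimately have "(\<lambda>m. real (n m choose r) / real (n m) ^ r * (real (n m) * Q m (\<mu> m + \<sigma> m * u m + d)) ^ r)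
          \<longlonglongrightarrow> 1 / fact r * exp (- y) ^ r"
        by (intro tendsto_mult tendsto_power)
      moreover have "real (n m choose r) / real (n m) ^ r * (real (n m) * Q m s) ^ r = real (n m choose r) * Q m s ^ r"
        for m s
        using n1[of m] by (simp add: power_mult_distrib)
      ultimately show ?thesis
        by simp
    qed
    show ?thesis
    proof (rule tendsto_sandwich[OF always_eventually always_eventually])
      show "\<forall>m. real (n m choose r) * Q m (\<mu> m + \<sigma> m * u m + real r) ^ r
          \<le> factorial_moment (D m) {1..n m} (\<lambda>i. {G. \<mu> m + \<sigma> m * u m < vertex_degree (n m) G i}) r"
        unfolding Q_def D_def by (intro allI factorial_moment_bounds[OF model])
      show "\<forall>m. factorial_moment (D m) {1..n m} (\<lambda>i. {G. \<mu> m + \<sigma> m * u m < vertex_degree (n m) G i}) r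
          \<le> real (n m choose r) * Q m (\<mu> m + \<sigma> m * u m + - real r) ^ r"
        unfolding Q_def D_def add_uminus_conv_diff by (intro allI factorial_moment_bounds[OF model])
    qed (rule shifted)+
  qed
  have "(\<lambda>m. measure_pmf.prob (D m) {G. \<forall>i\<in>{1..n m}. G \<notin> {G. \<mu> m + \<sigma> m * u m < vertex_degree (n m) G i}})
      \<longlonglongrightarrow> exp (- exp (- y))"
    by (rule prob_no_event_tendsto_poisson[OF _ moments]) simp
  moreover have "{G. \<forall>i\<in>{1..n m}. G \<notin> {G. \<mu> m + \<sigma> m * u m < vertex_degree (n m) G i}} =
      {G. ((MAX i\<in>{1..n m}. vertex_degree (n m) G i) - \<mu> m) / \<sigma> m \<le> u m}" for m
  proof -
    have "((MAX i\<in>{1..n m}. vertex_degree (n m) G i) - \<mu> m) / \<sigma> m \<le> u m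
        \<longleftrightarrow> (MAX i\<in>{1..n m}. vertex_degree (n m) G i) \<le> \<mu> m + \<sigma> m * u m" for G
      using \<sigma>_pos[of m] by (simp add: pos_divide_le_eq algebra_simps)
    moreover have "(MAX i\<in>{1..n m}. vertex_degree (n m) G i) \<le> \<mu> m + \<sigma> m * u m
        \<longleftrightarrow> (\<forall>i\<in>{1..n m}. vertex_degree (n m) G i \<le> \<mu> m + \<sigma> m * u m)" for G
      using one[of m] by (subst Max_le_iff) auto
    ultimately show ?thesis
      by (simp only: mem_Collect_eq not_less)
  qed
  ultimately show ?thesis
    unfolding u_def L_def by simp
qed

theorem theorem3p6:
  fixes k :: nat and C :: "nat \<Rightarrow> nat set set" and a b :: "nat \<Rightarrow> real" and y :: real
  assumes "k \<ge> 1"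
    and "\<forall>\<^sub>F n in multiples_at_top k. C n \<in> balanced_partitions k n"
    and "\<forall>\<^sub>F n in multiples_at_top k. 0 < b n \<and> b n < a n \<and> a n \<le> real n / 2"
    and "0 < Liminf (multiples_at_top k) (\<lambda>n. ereal (b n / a n))"
    and "Limsup (multiples_at_top k) (\<lambda>n. ereal (b n / a n)) < 1"
    and "\<exists>l. ((\<lambda>n. a n / real n) \<longlongrightarrow> l) (multiples_at_top k)"
    and "\<exists>l. ((\<lambda>n. b n / real n) \<longlongrightarrow> l) (multiples_at_top k)"
    and "filterlim (\<lambda>n. b n / ln (real n) ^ 3) at_top (multiples_at_top k)"
  shows "((\<lambda>n.
      let P = sbm_pmf n (C n) (a n) (b n);
          \<mu> = measure_pmf.expectation P (\<lambda>G. vertex_degree n G 1);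
          \<sigma> = sqrt (measure_pmf.variance P (\<lambda>G. vertex_degree n G 1))
      in measure_pmf.prob P
          {G. ((MAX i\<in>{1..n}. vertex_degree n G i) - \<mu>) / \<sigma>
                \<le> sqrt (2 * ln (real n)) *
                    (1 - (ln (ln (real n)) + ln (4 * pi)) / (4 * ln (real n))
                       + y / (2 * ln (real n)))})
    \<longlongrightarrow> exp (- exp (- y))) (multiples_at_top k)"
proof -
  note filter = multiples_at_top_conv_filtermap[OF assms(1)]
  have "\<forall>\<^sub>F m in sequentially. C (k * m) \<in> balanced_partitions k (k * m) \<and>
      (0 < b (k * m) \<and> b (k * m) < a (k * m) \<and> a (k * m) \<le> real (k * m) / 2) \<and> 2 \<le> m"
    using assms(2,3) unfolding filter eventually_filtermap
    by (intro eventually_conj[OF _ eventually_conj[OF _ eventually_ge_at_top]])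
  then obtain m0 where m0: "\<And>m. m0 \<le> m \<Longrightarrow> C (k * m) \<in> balanced_partitions k (k * m) \<and>
      (0 < b (k * m) \<and> b (k * m) < a (k * m) \<and> a (k * m) \<le> real (k * m) / 2) \<and> 2 \<le> m"
    unfolding eventually_sequentially by blast
  define n where "n = (\<lambda>m. k * (m + m0))"
  have m_le_n: "m + m0 \<le> n m" for m
    using assms(1) by (simp add: n_def)
  have shift: "filterlim (\<lambda>m. m + m0) sequentially sequentially"
    by (rule filterlim_add_const_nat_at_top)
  have "(\<lambda>m. measure_pmf.prob (sbm_pmf (n m) (C (n m)) (a (n m)) (b (n m)))
      {G. ((MAX i\<in>{1..n m}. vertex_degree (n m) G i) -
            measure_pmf.expectation (sbm_pmf (n m) (C (n m)) (a (n m)) (b (n m))) (\<lambda>G. vertex_degree (n m) G 1)) /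
          sqrt (measure_pmf.variance (sbm_pmf (n m) (C (n m)) (a (n m)) (b (n m))) (\<lambda>G. vertex_degree (n m) G 1))
            \<le> gumbel_threshold y (ln (real (n m)))}) \<longlonglongrightarrow> exp (- exp (- y))"
  proof (rule max_degree_tendsto_gumbel[OF assms(1)])
    show "2 \<le> n m" for m
      using m0[of "m + m0"] m_le_n[of m] by simp
    show "filterlim n at_top sequentially"
      by (rule filterlim_at_top_mono[OF shift]) (use m_le_n in simp)
    show "C (n m) \<in> balanced_partitions k (n m)"
      "0 < b (n m) \<and> b (n m) < a (n m) \<and> a (n m) \<le> real (n m) / 2" for m
      using m0[of "m + m0"] by (simp_all add: n_def)
    show "filterlim (\<lambda>m. b (n m) / ln (real (n m)) ^ 3) at_top sequentially"
      using filterlim_compose[OF assms(8)[unfolded filter filterlim_filtermap] shift] by (simp add: n_def)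
  qed
  thus ?thesis
    unfolding filter filterlim_filtermap Let_def n_def gumbel_threshold_def
    by (rule LIMSEQ_offset)
qed

end
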